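(* Let $q$ be a prime power, let $\alpha_1,\alpha_2$ be independent Haar-random elements of $\mathfrak p=t^{-1}\mathbb F_q[[t^{-1}]]$, and let $n\ge0$. With the notation of the context (for $r=2$), almost surely $$\mathbb P\bigl(I_n=1\mid\mathcal F_{T_n+1}\bigr)=\frac{\mathbf 1_{\{J^{(2)}_n=1\}}}{q},\qquad \mathbb P\bigl(I_n=2\mid\mathcal F_{T_n+1}\bigr)=\mathbf 1_{\{J^{(2)}_n=1\}}\Bigl(1-\frac1q\Bigr).$$ That is, on $\{J^{(2)}_n=1\}$, the jump is decided at the first increase of $\dim\ker H(n;D_n+k)$ in $k$ (i.e. $\Delta^{(2)}_n=\tau_{n,1}$) with conditional probability $1/q$, and if it is not, it occurs surely at the second increase (i.e. $\Delta^{(2)}_n=\tau_{n,2}$). In particular, $$\Delta^{(2)}_n\le 2n+3-D_n,$$ and, for every integer $h\ge3$, $$\mathbb P\bigl(\Delta^{(2)}_n\ge h\mid J^{(2)}_n=1\bigr)\le\frac{q^{3-h}}{q-1}.$$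
   Context: Write $\alpha_i=\sum_{j\ge1}u^{(i)}_jt^{-j}$, $i=1,2$, with $u^{(i)}_j\in\mathbb F_q$. Under product Haar probability measure on $\mathfrak p^2$ the coefficient vectors $(u^{(1)}_j,u^{(2)}_j)$, $j\ge1$, are iid uniform on $\mathbb F_q^2$. For $n\ge0$, $d\ge1$ let $H(n;d)$ be the $2n\times d$ matrix over $\mathbb F_q$ obtained by stacking, for $i=1,2$, the $n\times d$ Hankel blocks with $(a,b)$ entry $u^{(i)}_{a+b-1}$ (for $n=0$ the empty matrix with $d$ columns, whose kernel is $\mathbb F_q^d$). A vector $(\theta_0,\ldots,\theta_{d-1})^{\mathsf T}$ lies in $\ker H(n;d)$ exactly when, for $Q=\sum_k\theta_kt^k$, the coefficients of $t^{-1},\ldots,t^{-n}$ in $Q\alpha_1$ and $Q\alpha_2$ vanish. Put $$D_n=L_2(n)=\min\{d\ge1:\ker H(n;d)\ne0\},\quad \Delta^{(2)}_n=D_{n+1}-D_n,\quad J^{(2)}_n=\mathbf 1_{\{D_{n+1}>D_n\}},\quad T_n=n+D_n-1.$$ For $k\ge0$ let $\nu_{n,k}=\dim\ker H(n;D_n+k)$; one has $\nu_{n,0}=1$ and $\nu_{n,k}-\nu_{n,k-1}\in\{0,1\}$. For $j=1,2$ let $\tau_{n,j}=\inf\{k\ge1:\nu_{n,k}=j+1\}$, which is always finite. The index $I_n$ is $0$ on $\{J^{(2)}_n=0\}$, and on $\{J^{(2)}_n=1\}$ it is the unique $j\in\{1,2\}$ with $\Delta^{(2)}_n=\tau_{n,j}$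 (such a $j$ always exists). $\mathcal F_N=\sigma(u^{(i)}_j:1\le i\le2,\ 1\le j\le N)$ for $N\ge0$. $T_n$ (hence $T_n+1$) is a stopping time for $(\mathcal F_N)_{N\ge0}$, and for a stopping time $T$, $\mathcal F_T=\{A:A\cap\{T\le N\}\in\mathcal F_N\text{ for every }N\ge0\}$. *)

theory Defs
  imports
    "HOL-Probability.Probability"
    "HOL-Computational_Algebra.Formal_Power_Series"
    "Jordan_Normal_Form.Matrix_Kernel"
begin

text \<open>
  The field \<open>F\<^sub>q\<close> is a type \<open>'a\<close> of sort \<open>{field, finite}\<close> and \<open>q = CARD('a)\<close>.
  The variable of \<open>'a fps\<close> stands for \<open>t\<^sup>-\<^sup>1\<close>: the coefficient of \<open>t\<^sup>-\<^sup>j\<close> in \<open>a\<close> is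
  \<open>fps_nth a j\<close>, and the library metric on \<open>'a fps\<close> induces the \<open>t\<^sup>-\<^sup>1\<close>-adic topology.
\<close>

definition pp :: "'a::field fps set" where
  "pp = range (\<lambda>f. fps_X * f)"

definition borel_pp :: "'a::field fps measure" where
  "borel_pp = restrict_space borel pp"

text \<open>
  The Haar probability measure of the compact additive group \<open>pp\<close>, characterised as usual as the
  translation-invariant Borel probability measure.
\<close>

definition haar_prob_measure :: "'a::field fps measure \<Rightarrow> bool" where
  "haar_prob_measure \<mu> \<longleftrightarrow>
     prob_space \<mu> \<and> sets \<mu> = sets borel_pp \<and> (\<forall>c\<in>pp. distr \<mu> \<mu> (\<lambda>x. c + x) = \<mu>)"

definition haar_random :: "'w measure \<Rightarrow> ('w \<Rightarrow> 'a::field fps) \<Rightarrow> bool" where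
  "haar_random M X \<longleftrightarrow> X \<in> M \<rightarrow>\<^sub>M borel_pp \<and> haar_prob_measure (distr M borel_pp X)"

text \<open>Rows and columns are indexed from 0, so the entry \<open>u\<^bsub>a+b-1\<^esub>\<close> becomes \<open>u\<^bsub>a+b+1\<^esub>\<close>.\<close>

definition hankel_block :: "nat \<Rightarrow> nat \<Rightarrow> 'a::field fps \<Rightarrow> 'a mat" where
  "hankel_block n d a = mat n d (\<lambda>(i, j). fps_nth a (i + j + 1))"

definition hankel :: "'a::field fps \<times> 'a fps \<Rightarrow> nat \<Rightarrow> nat \<Rightarrow> 'a mat" where
  "hankel \<alpha> n d = hankel_block n d (fst \<alpha>) @\<^sub>r hankel_block n d (snd \<alpha>)"

definition Dn :: "'a::field fps \<times> 'a fps \<Rightarrow> nat \<Rightarrow> nat" where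
  "Dn \<alpha> n = (LEAST d. d \<ge> 1 \<and> mat_kernel (hankel \<alpha> n d) \<noteq> {0\<^sub>v d})"

definition Deltan :: "'a::field fps \<times> 'a fps \<Rightarrow> nat \<Rightarrow> int" where
  "Deltan \<alpha> n = int (Dn \<alpha> (n + 1)) - int (Dn \<alpha> n)"

definition Jn :: "'a::field fps \<times> 'a fps \<Rightarrow> nat \<Rightarrow> nat" where
  "Jn \<alpha> n = (if Dn \<alpha> (n + 1) > Dn \<alpha> n then 1 else 0)"

definition Tn :: "'a::field fps \<times> 'a fps \<Rightarrow> nat \<Rightarrow> nat" where
  "Tn \<alpha> n = n + Dn \<alpha> n - 1"

definition nu :: "'a::field fps \<times> 'a fps \<Rightarrow> nat \<Rightarrow> nat \<Rightarrow> nat" where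
  "nu \<alpha> n k = kernel_dim (hankel \<alpha> n (Dn \<alpha> n + k))"

text \<open>
  The set below is never empty for \<open>j = 1, 2\<close>: \<open>nu \<alpha> n\<close> starts at 1, grows by steps of at most 1
  and is unbounded. So the infimum may be taken in \<open>nat\<close>.
\<close>

definition tau :: "'a::field fps \<times> 'a fps \<Rightarrow> nat \<Rightarrow> nat \<Rightarrow> nat" where
  "tau \<alpha> n j = Inf {k. k \<ge> 1 \<and> nu \<alpha> n k = j + 1}"

definition In :: "'a::field fps \<times> 'a fps \<Rightarrow> nat \<Rightarrow> nat" where
  "In \<alpha> n = (if Jn \<alpha> n = 0 then 0 else (THE j. j \<in> {1, 2} \<and> Deltan \<alpha> n = int (tau \<alpha> n j)))"

text \<open>The \<open>\<sigma>\<close>-algebra on the sample space generated by the coefficients of index \<open>1, \<dots>, N\<close>.\<close>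

definition coeff_filtration ::
    "'w measure \<Rightarrow> ('w \<Rightarrow> 'a::field fps \<times> 'a fps) \<Rightarrow> nat \<Rightarrow> 'w measure" where
  "coeff_filtration M \<alpha> N = sigma (space M)
     {{\<omega> \<in> space M. fps_nth (p (\<alpha> \<omega>)) j \<in> S} | p j S. p \<in> {fst, snd} \<and> 1 \<le> j \<and> j \<le> N}"

definition stopped_sigma ::
    "'w measure \<Rightarrow> ('w \<Rightarrow> 'a::field fps \<times> 'a fps) \<Rightarrow> ('w \<Rightarrow> nat) \<Rightarrow> 'w measure" where
  "stopped_sigma M \<alpha> T = filtration.pre_sigma (space M) (coeff_filtration M \<alpha>) T"

definition cond_prob_given :: "'w measure \<Rightarrow> 'w measure \<Rightarrow> ('w \<Rightarrow> bool) \<Rightarrow> 'w \<Rightarrow> real" where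
  "cond_prob_given M F P = real_cond_exp M F (indicat_real {\<omega> \<in> space M. P \<omega>})"

end

theory Submission
  imports Defs
begin

text \<open>
  A vector in the kernel of the Hankel matrix of shape \<open>(n, d)\<close> is a polynomial \<open>Q\<close> of degree less
  than \<open>d\<close> such that the coefficients of \<open>t\<^sup>-\<^sup>1, \<dots>, t\<^sup>-\<^sup>n\<close> in \<open>Q \<alpha>\<^sub>1\<close> and \<open>Q \<alpha>\<^sub>2\<close> vanish; such a \<open>Q\<close> is
  called an annihilator of level \<open>n\<close> here, and \<open>degree Q + 1\<close> is its length. Adding one column raises
  the dimension of the kernel exactly when the new length is attained. So if
  \<open>\<ell>\<^sub>0 < \<ell>\<^sub>1 < \<ell>\<^sub>2 < \<dots>\<close> are the lengths of nonzero annihilators of level \<open>n\<close>, then \<open>D\<^sub>n = \<ell>\<^sub>0\<close> and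
  \<open>\<tau>\<^sub>j = \<ell>\<^sub>j - \<ell>\<^sub>0\<close>.

  Choose monic annihilators \<open>P\<close>, \<open>Q\<close>, \<open>R\<close> of lengths \<open>\<ell>\<^sub>0\<close>, \<open>\<ell>\<^sub>1\<close>, \<open>\<ell>\<^sub>2\<close>, and look at their
  discrepancies, the pairs of coefficients of \<open>t\<^sup>-\<^sup>(\<^sup>n\<^sup>+\<^sup>1\<^sup>)\<close>. There is a jump iff the discrepancy \<open>w\<close> of
  \<open>P\<close> is nonzero. In that case, if the discrepancy of \<open>Q\<close> is a multiple of \<open>w\<close>, a combination of \<open>Q\<close>
  and \<open>P\<close> has level \<open>n + 1\<close> and \<open>D\<^sub>n\<^sub>+\<^sub>1 = \<ell>\<^sub>1\<close>; otherwise \<open>D\<^sub>n\<^sub>+\<^sub>1 = \<ell>\<^sub>2\<close>, because three vectors of a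
  plane are linearly dependent. These are the lemmas \<open>Dn_Suc_eq_iff\<close>, \<open>Dn_Suc_eq_second_iff\<close> and
  \<open>Dn_Suc_cases\<close>.

  The probability \<open>1/q\<close> comes from a fresh coefficient. The coefficients of index below \<open>n + \<ell>\<^sub>1\<close>
  suffice to choose \<open>P\<close> and \<open>Q\<close>, and they determine \<open>w\<close> and every event of the \<sigma>-algebra stopped at \<open>T\<^sub>n + 1 = n + \<ell>\<^sub>0\<close>, while the pair
  of index \<open>n + \<ell>\<^sub>1\<close> enters the discrepancy of \<open>Q\<close> additively, since \<open>Q\<close> is monic. Hence that
  discrepancy is uniform on the plane and lies on the line spanned by \<open>w\<close> with probability
  \<open>q / q\<^sup>2\<close>. All events in question depend on the first \<open>3n + 3\<close> coefficients only, whose law is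
  uniform on a finite set, so the argument is carried out by double counting: \<open>card_by_resampling\<close>
  replaces a coefficient at a random index that does not depend on its own value.

  For the tail bound, \<open>D\<^sub>n\<^sub>+\<^sub>1 \<le> 2n + 3\<close> for lack of equations, so a jump by \<open>h\<close> forces
  \<open>D\<^sub>n \<le> 2n + 3 - h\<close>. The pair of index \<open>n + \<ell>\<^sub>0\<close> is fresh too, which makes the jump independent of
  \<open>D\<^sub>n\<close> (\<open>card_jump\<close>). Finally a nonzero polynomial of degree less than \<open>d\<close> is an annihilator of
  level \<open>n\<close> with probability \<open>q\<^sup>-\<^sup>2\<^sup>n\<close>, and annihilators come in families of \<open>q - 1\<close> scalar multiples, so
  \<open>(q - 1) P(D\<^sub>n \<le> d) \<le> q\<^sup>d\<^sup>-\<^sup>2\<^sup>n\<close> (\<open>card_Dn_le\<close>).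
\<close>

section \<open>Kernels over a finite field\<close>

lemma card_field_gt_1: "CARD('a::{field, finite}) > 1"
  using card_mono[of UNIV "{0, 1 :: 'a}"] by simp

lemma finite_carrier_vec:
  assumes "finite (UNIV :: 'a set)"
  shows "finite (carrier_vec n :: 'a vec set)"
proof (rule finite_surj)
  show "finite {xs :: 'a list. length xs = n}"
    using finite_lists_length_eq[OF assms, of n] by simp
  show "carrier_vec n \<subseteq> vec_of_list ` {xs :: 'a list. length xs = n}"
  proof
    fix v :: "'a vec" assume "v \<in> carrier_vec n"
    then show "v \<in> vec_of_list ` {xs. length xs = n}"
      by (intro image_eqI[of _ _ "list_of_vec v"]) (auto simp: vec_list)
  qed
qed

text \<open>
  Over a finite field a dimension can be read off from a cardinality. This lets the rest of the
  argument count kernel vectors and never touch a basis.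
\<close>

lemma (in kernel) card_mat_kernel:
  assumes "finite (UNIV :: 'a set)"
  shows "card (mat_kernel A) = CARD('a) ^ kernel_dim A"
proof -
  have fin: "finite (mat_kernel A)"
    using mat_kernel_carrier[OF A] finite_carrier_vec[OF assms] by (rule finite_subset)
  have "Ker.span (mat_kernel A) = mat_kernel A"
    using Ker.in_own_span[of "mat_kernel A"] Ker.span_is_subset2[of "mat_kernel A"] by auto
  then have "Ker.fin_dim" unfolding Ker.fin_dim_def using fin by blast
  then obtain b where b: "finite b" "Ker.basis b"
    using Ker.finite_basis_exists by blast
  then have sub: "b \<subseteq> mat_kernel A" unfolding Ker.basis_def by blast
  have *: "\<forall>v. v \<in> mat_kernel A \<longrightarrow> (\<exists>!a. a \<in> b \<rightarrow>\<^sub>E UNIV \<and> lincomb a b = v)"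
    using Ker.basis_criterion[OF b(1) sub] b(2) by simp
  have cl: "lincomb a b \<in> mat_kernel A" for a
    using Ker.lincomb_closed[OF sub, of a] by simp
  have "bij_betw (\<lambda>a. lincomb a b) (b \<rightarrow>\<^sub>E UNIV) (mat_kernel A)"
  proof (rule bij_betw_imageI)
    show "inj_on (\<lambda>a. lincomb a b) (b \<rightarrow>\<^sub>E UNIV)"
      using * cl by (intro inj_onI) metis
    show "(\<lambda>a. lincomb a b) ` (b \<rightarrow>\<^sub>E UNIV) = mat_kernel A"
      using * cl by blast
  qed
  then have "card (mat_kernel A) = card (b \<rightarrow>\<^sub>E (UNIV :: 'a set))"
    by (simp add: bij_betw_same_card)
  also have "\<dots> = CARD('a) ^ card b" using b(1) by (simp add: card_PiE)
  finally show ?thesis using Ker.dim_basis[OF b] by simp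
qed

section \<open>Annihilators and Hankel kernels\<close>

text \<open>
  The coefficients of \<open>t\<^sup>-\<^sup>m\<close> in the two products of \<open>Q\<close>, a polynomial in \<open>t\<close>, with the components of
  \<open>\<alpha>\<close>. For \<open>m = n + 1\<close> and \<open>Q\<close> an annihilator of level \<open>n\<close> this is the discrepancy of \<open>Q\<close>.
\<close>

definition tail_coeff :: "'a::field fps \<times> 'a fps \<Rightarrow> 'a poly \<Rightarrow> nat \<Rightarrow> 'a \<times> 'a" where
  "tail_coeff \<alpha> Q m =
     ((\<Sum>k\<le>degree Q. coeff Q k * fps_nth (fst \<alpha>) (m + k)),
      (\<Sum>k\<le>degree Q. coeff Q k * fps_nth (snd \<alpha>) (m + k)))"

text \<open>
  The number of summands may be any bound on the degree; a common bound for two polynomials is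
  what makes linearity a computation with finite sums.
\<close>

lemma tail_coeff_bounded:
  assumes "\<And>k. k \<ge> d \<Longrightarrow> coeff Q k = 0"
  shows "tail_coeff \<alpha> Q m =
     ((\<Sum>k<d. coeff Q k * fps_nth (fst \<alpha>) (m + k)),
      (\<Sum>k<d. coeff Q k * fps_nth (snd \<alpha>) (m + k)))"
proof -
  have "(\<Sum>k\<le>degree Q. coeff Q k * f k) = (\<Sum>k<d. coeff Q k * f k)" for f :: "nat \<Rightarrow> 'a"
    using assms by (intro sum.mono_neutral_cong) (auto simp: coeff_eq_0 not_le not_less)
  then show ?thesis by (simp add: tail_coeff_def)
qed

lemma tail_coeff_linear:
  fixes \<alpha> :: "'a::field fps \<times> 'a fps"
  shows "tail_coeff \<alpha> (P + Polynomial.smult c Q) m =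
    (fst (tail_coeff \<alpha> P m) + c * fst (tail_coeff \<alpha> Q m),
     snd (tail_coeff \<alpha> P m) + c * snd (tail_coeff \<alpha> Q m))"
proof -
  define d where "d = Suc (max (degree P) (degree Q))"
  have d: "coeff P k = 0" "coeff Q k = 0" "coeff (P + Polynomial.smult c Q) k = 0" if "k \<ge> d" for k
    using that by (auto simp: d_def coeff_eq_0)
  show ?thesis
    by (simp only: tail_coeff_bounded[of d, OF d(1)] tail_coeff_bounded[of d, OF d(2)]
        tail_coeff_bounded[of d, OF d(3)])
       (simp add: algebra_simps sum.distrib sum_distrib_left)
qed

lemma tail_coeff_0 [simp]: "tail_coeff \<alpha> 0 m = 0"
  by (simp add: tail_coeff_def zero_prod_def)

definition annihilators :: "'a::field fps \<times> 'a fps \<Rightarrow> nat \<Rightarrow> 'a poly set" where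
  "annihilators \<alpha> n = {Q. \<forall>m\<in>{1..n}. tail_coeff \<alpha> Q m = 0}"

lemma annihilators_linear:
  assumes "P \<in> annihilators \<alpha> n" "Q \<in> annihilators \<alpha> n"
  shows "P + Polynomial.smult c Q \<in> annihilators \<alpha> n"
  using assms by (simp add: annihilators_def tail_coeff_linear zero_prod_def)

lemma zero_in_annihilators [simp]: "0 \<in> annihilators \<alpha> n"
  by (simp add: annihilators_def)

lemma annihilators_diff:
  assumes "P \<in> annihilators \<alpha> n" "Q \<in> annihilators \<alpha> n"
  shows "P - Polynomial.smult c Q \<in> annihilators \<alpha> n"
  using annihilators_linear[OF assms, of "- c"] by simp

lemma annihilators_smult:
  assumes "Q \<in> annihilators \<alpha> n"
  shows "Polynomial.smult c Q \<in> annihilators \<alpha> n"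
  using annihilators_linear[OF zero_in_annihilators assms, of c] by simp

lemma annihilators_Suc:
  "Q \<in> annihilators \<alpha> (Suc n) \<longleftrightarrow> Q \<in> annihilators \<alpha> n \<and> tail_coeff \<alpha> Q (Suc n) = 0"
  by (auto simp: annihilators_def atLeastAtMostSuc_conv)

definition short_annihilators :: "'a::field fps \<times> 'a fps \<Rightarrow> nat \<Rightarrow> nat \<Rightarrow> 'a poly set" where
  "short_annihilators \<alpha> n d = {Q \<in> annihilators \<alpha> n. \<forall>k\<ge>d. coeff Q k = 0}"

text \<open>
  A kernel vector with \<open>d\<close> entries and nonzero last entry is an annihilator of degree \<open>d - 1\<close>, so it is
  the degree plus one, not the degree, that compares with numbers of columns.
\<close>

definition ann_lengths :: "'a::field fps \<times> 'a fps \<Rightarrow> nat \<Rightarrow> nat set" where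
  "ann_lengths \<alpha> n = {Suc (degree Q) | Q. Q \<in> annihilators \<alpha> n \<and> Q \<noteq> 0}"

lemma short_iff: "(\<forall>k\<ge>d. coeff Q k = 0) \<longleftrightarrow> Q = 0 \<or> Suc (degree Q) \<le> d"
proof
  assume *: "\<forall>k\<ge>d. coeff Q k = 0"
  show "Q = 0 \<or> Suc (degree Q) \<le> d"
  proof (rule ccontr)
    assume "\<not> ?thesis"
    then have "Q \<noteq> 0" "d \<le> degree Q" by auto
    then show False using * leading_coeff_0_iff by blast
  qed
qed (auto simp: coeff_eq_0)

lemma ann_lengths_ge_1: "d \<in> ann_lengths \<alpha> n \<Longrightarrow> d \<ge> 1"
  by (auto simp: ann_lengths_def)

lemma monic_annihilator:
  assumes "d \<in> ann_lengths \<alpha> n"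
  obtains Q where "Q \<in> annihilators \<alpha> n" "lead_coeff Q = 1" "Suc (degree Q) = d"
proof -
  obtain Q where Q: "Q \<in> annihilators \<alpha> n" "Q \<noteq> 0" "d = Suc (degree Q)"
    using assms by (auto simp: ann_lengths_def)
  show ?thesis
    by (rule that[of "Polynomial.smult (inverse (lead_coeff Q)) Q"])
       (use Q in \<open>auto intro: annihilators_smult\<close>)
qed

lemma ann_lengthsI: "Q \<in> annihilators \<alpha> n \<Longrightarrow> Q \<noteq> 0 \<Longrightarrow> Suc (degree Q) \<in> ann_lengths \<alpha> n"
  by (auto simp: ann_lengths_def)

lemma ann_lengths_Suc_subset: "ann_lengths \<alpha> (Suc n) \<subseteq> ann_lengths \<alpha> n"
  by (auto simp: ann_lengths_def annihilators_Suc)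

text \<open>
  The first \<open>n\<close> rows of the Hankel matrix compute the first components of \<open>tail_coeff\<close>, and the last
  \<open>n\<close> rows the second ones.
\<close>

lemma bij_hankel_kernel:
  "bij_betw (\<lambda>Q. vec d (coeff Q)) (short_annihilators \<alpha> n d) (mat_kernel (hankel \<alpha> n d))"
proof -
  let ?H = "hankel \<alpha> n d"
  have c: "?H \<in> carrier_mat (n + n) d"
    unfolding hankel_def by (rule carrier_append_rows) (auto simp: hankel_block_def)
  have H: "?H = mat (n + n) d (\<lambda>(i, j). if i < n then fps_nth (fst \<alpha>) (Suc i + j)
      else fps_nth (snd \<alpha>) (Suc (i - n) + j))"
    by (rule eq_matI) (auto simp: hankel_def hankel_block_def append_rows_def)
  have row1: "row ?H i \<bullet> v = (\<Sum>k<d. v $ k * fps_nth (fst \<alpha>) (Suc i + k))"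
    if "i < n" "v \<in> carrier_vec d" for i and v :: "'a vec"
    using that by (auto simp: H scalar_prod_def lessThan_atLeast0 mult.commute intro!: sum.cong)
  have row2: "row ?H (n + i) \<bullet> v = (\<Sum>k<d. v $ k * fps_nth (snd \<alpha>) (Suc i + k))"
    if "i < n" "v \<in> carrier_vec d" for i and v :: "'a vec"
    using that by (auto simp: H scalar_prod_def lessThan_atLeast0 mult.commute intro!: sum.cong)
  have ker: "v \<in> mat_kernel ?H \<longleftrightarrow> Q \<in> annihilators \<alpha> n"
    if v: "v \<in> carrier_vec d" and Q: "\<And>k. k < d \<Longrightarrow> coeff Q k = v $ k" "\<And>k. k \<ge> d \<Longrightarrow> coeff Q k = 0"
    for v Q
  proof -
    have tc: "tail_coeff \<alpha> Q (Suc i) = (row ?H i \<bullet> v, row ?H (n + i) \<bullet> v)" if "i < n" for i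
      using Q(1) that v by (simp add: tail_coeff_bounded[of d, OF Q(2)] row1 row2)
    have "v \<in> mat_kernel ?H \<longleftrightarrow> (\<forall>i<n+n. row ?H i \<bullet> v = 0)"
      using v c unfolding mat_kernel[OF c] by (auto simp: vec_eq_iff)
    also have "\<dots> \<longleftrightarrow> (\<forall>i<n. row ?H i \<bullet> v = 0 \<and> row ?H (n + i) \<bullet> v = 0)"
      by (auto) (metis add_diff_inverse_nat nat_add_left_cancel_less)
    also have "\<dots> \<longleftrightarrow> (\<forall>i<n. tail_coeff \<alpha> Q (Suc i) = 0)"
      by (simp add: tc zero_prod_def)
    also have "\<dots> \<longleftrightarrow> Q \<in> annihilators \<alpha> n"
      unfolding annihilators_def
      by (auto simp: Suc_le_eq) (metis One_nat_def Suc_le_eq Suc_pred' Suc_le_D)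
    finally show ?thesis .
  qed
  show ?thesis
  proof (rule bij_betwI[where g = "\<lambda>v. Poly (list_of_vec v)"])
    show "(\<lambda>Q. vec d (coeff Q)) \<in> short_annihilators \<alpha> n d \<rightarrow> mat_kernel ?H"
      by (auto simp: short_annihilators_def ker)
    have co: "coeff (Poly (list_of_vec v)) k = (if k < d then v $ k else 0)" 
      if "v \<in> carrier_vec d" for v :: "'a vec" and k
      using that by (auto simp: nth_default_def list_of_vec_index)
    show "(\<lambda>v. Poly (list_of_vec v)) \<in> mat_kernel ?H \<rightarrow> short_annihilators \<alpha> n d"
    proof
      fix v assume v: "v \<in> mat_kernel ?H"
      then have "v \<in> carrier_vec d" using mat_kernel_carrier[OF c] by auto
      then show "Poly (list_of_vec v) \<in> short_annihilators \<alpha> n d"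
        using v ker[of v "Poly (list_of_vec v)"] co by (auto simp: short_annihilators_def)
    qed
    show "Poly (list_of_vec (vec d (coeff Q))) = Q" if "Q \<in> short_annihilators \<alpha> n d" for Q
      using that by (intro poly_eqI) (subst co, auto simp: short_annihilators_def)
    show "vec d (coeff (Poly (list_of_vec v))) = v" if "v \<in> mat_kernel ?H" for v
      using that mat_kernel_carrier[OF c] by (intro eq_vecI) (auto simp: co subset_iff simp del: coeff_Poly_eq)
  qed
qed


lemma card_polys_of_bounded_degree:
  fixes d :: nat
  defines "S \<equiv> {Q :: 'a::{comm_monoid_add, finite} poly. \<forall>k\<ge>d. coeff Q k = 0}"
  shows "finite S" and "card S = CARD('a) ^ d"
proof -
  have "finite {Q :: 'a poly. \<forall>k\<ge>d. coeff Q k = 0} \<and> 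
        card {Q :: 'a poly. \<forall>k\<ge>d. coeff Q k = 0} = CARD('a) ^ d"
  proof (induction d)
    case 0
    have "{Q :: 'a poly. \<forall>k\<ge>0. coeff Q k = 0} = {0}" by (auto simp: poly_eq_iff)
    then show ?case by simp
  next
    case (Suc d)
    have eq: "{Q :: 'a poly. \<forall>k\<ge>Suc d. coeff Q k = 0} =
        (\<lambda>(c, Q). pCons c Q) ` (UNIV \<times> {Q. \<forall>k\<ge>d. coeff Q k = 0})"
    proof (intro equalityI subsetI)
      fix Q :: "'a poly" assume Q: "Q \<in> {Q. \<forall>k\<ge>Suc d. coeff Q k = 0}"
      show "Q \<in> (\<lambda>(c, Q). pCons c Q) ` (UNIV \<times> {Q. \<forall>k\<ge>d. coeff Q k = 0})"
      proof (cases Q)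
        case (pCons c R)
        have "coeff R k = 0" if "k \<ge> d" for k
          using Q pCons that by (auto dest: spec[of _ "Suc k"])
        then show ?thesis using pCons by auto
      qed
    qed (auto simp: coeff_pCons split: nat.splits)
    have inj: "inj_on (\<lambda>(c, Q). pCons c Q) (UNIV \<times> {Q :: 'a poly. \<forall>k\<ge>d. coeff Q k = 0})"
      by (auto simp: inj_on_def)
    show ?case unfolding eq using Suc by (simp add: card_image[OF inj] card_cartesian_product)
  qed
  then show "finite S" "card S = CARD('a) ^ d" by (simp_all add: S_def)
qed

lemma short_annihilators_0 [simp]:
  "short_annihilators \<alpha> 0 d = {Q. \<forall>k\<ge>d. coeff Q k = 0}"
  by (simp add: short_annihilators_def annihilators_def)

lemma finite_short_annihilators [simp]:
  "finite (short_annihilators (\<alpha> :: 'a::{field,finite} fps \<times> 'a fps) n d)"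
  by (rule finite_subset[OF _ card_polys_of_bounded_degree(1)[of d]])
     (auto simp: short_annihilators_def)

text \<open>
  Passing from degree less than \<open>d\<close> to degree at most \<open>d\<close> adds at most one free parameter, the leading
  coefficient, and it is free exactly when some annihilator has degree \<open>d\<close>.
\<close>

lemma card_short_annihilators:
  fixes \<alpha> :: "'a::{field, finite} fps \<times> 'a fps"
  shows "card (short_annihilators \<alpha> n d) = CARD('a) ^ card (ann_lengths \<alpha> n \<inter> {..d})"
proof (induction d)
  case 0
  have "short_annihilators \<alpha> n 0 = {0}"
    by (auto simp: short_annihilators_def poly_eq_iff)
  moreover have "ann_lengths \<alpha> n \<inter> {..0} = {}" using ann_lengths_ge_1 by fastforce
  ultimately show ?case by simp
next
  case (Suc d)
  show ?case
  proof (cases "Suc d \<in> ann_lengths \<alpha> n")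
    case False
    then have "short_annihilators \<alpha> n (Suc d) = short_annihilators \<alpha> n d"
      unfolding short_annihilators_def short_iff by (auto simp: ann_lengths_def le_Suc_eq)
    moreover have "ann_lengths \<alpha> n \<inter> {..Suc d} = ann_lengths \<alpha> n \<inter> {..d}"
      using False by (auto simp: le_Suc_eq)
    ultimately show ?thesis using Suc by simp
  next
    case True
    then obtain R where R: "R \<in> annihilators \<alpha> n" "lead_coeff R = 1" "Suc (degree R) = Suc d"
      by (rule monic_annihilator)
    have Rd: "coeff R d = 1" "\<And>k. k > d \<Longrightarrow> coeff R k = 0" using R by (auto simp: coeff_eq_0)
    let ?f = "\<lambda>(c, Q). Q + Polynomial.smult c R"
    have "bij_betw ?f (UNIV \<times> short_annihilators \<alpha> n d) (short_annihilators \<alpha> n (Suc d))"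
    proof (rule bij_betwI[where g = "\<lambda>Q. (coeff Q d, Q - Polynomial.smult (coeff Q d) R)"])
      show "?f \<in> UNIV \<times> short_annihilators \<alpha> n d \<rightarrow> short_annihilators \<alpha> n (Suc d)"
        using R Rd by (auto simp: short_annihilators_def annihilators_linear)
      show "(\<lambda>Q. (coeff Q d, Q - Polynomial.smult (coeff Q d) R))
          \<in> short_annihilators \<alpha> n (Suc d) \<rightarrow> UNIV \<times> short_annihilators \<alpha> n d"
      proof (intro funcsetI SigmaI UNIV_I)
        fix Q assume Q: "Q \<in> short_annihilators \<alpha> n (Suc d)"
        then have Q': "Q \<in> annihilators \<alpha> n" "\<And>k. k \<ge> Suc d \<Longrightarrow> coeff Q k = 0"
          by (auto simp: short_annihilators_def)
        have "coeff (Q - Polynomial.smult (coeff Q d) R) k = 0" if "k \<ge> d" for k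
          using Q'(2)[of k] Rd(1) Rd(2)[of k] that by (cases "k = d") simp_all
        then show "Q - Polynomial.smult (coeff Q d) R \<in> short_annihilators \<alpha> n d"
          unfolding short_annihilators_def using annihilators_diff[OF Q'(1) R(1)] by blast
      qed
    qed (use Rd in \<open>auto simp: short_annihilators_def\<close>)
    then have "card (short_annihilators \<alpha> n (Suc d)) = CARD('a) * card (short_annihilators \<alpha> n d)"
      by (metis bij_betw_same_card card_cartesian_product)
    moreover have "ann_lengths \<alpha> n \<inter> {..Suc d} = insert (Suc d) (ann_lengths \<alpha> n \<inter> {..d})"
      using True by (auto simp: le_Suc_eq)
    ultimately show ?thesis using Suc by simp
  qed
qed

text \<open>
  One more level imposes two linear conditions, so each fibre of the discrepancy is empty or a
  translate of the kernel.
\<close>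

lemma card_short_annihilators_Suc:
  fixes \<alpha> :: "'a::{field, finite} fps \<times> 'a fps"
  shows "card (short_annihilators \<alpha> n d) \<le> CARD('a)\<^sup>2 * card (short_annihilators \<alpha> (Suc n) d)"
proof -
  let ?K = "short_annihilators \<alpha> n d" and ?L = "short_annihilators \<alpha> (Suc n) d"
  let ?w = "\<lambda>Q. tail_coeff \<alpha> Q (Suc n)"
  have fibre: "card {Q \<in> ?K. ?w Q = c} \<le> card ?L" for c
  proof (cases "{Q \<in> ?K. ?w Q = c} = {}")
    case False
    then obtain R where R: "R \<in> ?K" "?w R = c" by auto
    have "Q - R \<in> ?L" if "Q \<in> ?K" "?w Q = c" for Q
      using that R annihilators_diff[of Q \<alpha> n R 1] tail_coeff_linear[of \<alpha> Q "-1" R "Suc n"]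
      by (auto simp: short_annihilators_def annihilators_Suc zero_prod_def)
    then show ?thesis
      by (intro card_inj_on_le[where f = "\<lambda>Q. Q - R"]) (auto simp: inj_on_def)
  next
    case True
    then show ?thesis by (simp only: card.empty)
  qed
  have "card ?K = card (\<Union>c\<in>UNIV. {Q \<in> ?K. ?w Q = c})" by (rule arg_cong[of _ _ card]) auto
  also have "\<dots> \<le> (\<Sum>c\<in>UNIV. card {Q \<in> ?K. ?w Q = c})" by (rule card_UN_le) simp
  also have "\<dots> \<le> (\<Sum>c\<in>(UNIV :: ('a \<times> 'a) set). card ?L)" by (rule sum_mono) (rule fibre)
  finally show ?thesis by (simp add: card_cartesian_product flip: UNIV_Times_UNIV power2_eq_square)
qed

text \<open>
  Rank-nullity for the \<open>2n\<close> linear conditions, in counted form. It bounds all lengths used later.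
\<close>

lemma card_ann_lengths_ge:
  fixes \<alpha> :: "'a::{field, finite} fps \<times> 'a fps"
  shows "d \<le> 2 * n + card (ann_lengths \<alpha> n \<inter> {..d})"
proof -
  have "CARD('a) ^ d \<le> CARD('a) ^ (2 * n) * card (short_annihilators \<alpha> n d)"
  proof (induction n)
    case 0
    then show ?case by (simp add: card_polys_of_bounded_degree)
  next
    case (Suc n)
    have "CARD('a) ^ (2 * n) * card (short_annihilators \<alpha> n d)
        \<le> CARD('a) ^ (2 * n) * (CARD('a)\<^sup>2 * card (short_annihilators \<alpha> (Suc n) d))"
      by (intro mult_left_mono card_short_annihilators_Suc) simp
    from order.trans[OF Suc this] show ?case by (simp add: power2_eq_square mult_ac)
  qed
  then have "CARD('a) ^ d \<le> CARD('a) ^ (2 * n + card (ann_lengths \<alpha> n \<inter> {..d}))"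
    by (simp add: card_short_annihilators power_add)
  moreover have "CARD('a) > 1" by (rule card_field_gt_1)
  ultimately show ?thesis by (simp add: power_increasing_iff)
qed

section \<open>The lengths of annihilators as jump times of the kernel dimension\<close>

lemma card_less_enumerate:
  fixes S :: "nat set"
  assumes "infinite S"
  shows "card (S \<inter> {..<enumerate S j}) = j"
proof -
  have "S \<inter> {..<enumerate S j} = enumerate S ` {..<j}"
    using assms by (auto simp: enumerate_in_set) (metis enumerate_Ex enumerate_mono_iff image_eqI lessThan_iff)
  moreover have "inj_on (enumerate S) {..<j}"
    using enumerate_mono_iff[OF assms] by (auto simp: inj_on_def) (metis less_irrefl linorder_neqE_nat)
  ultimately show ?thesis by (simp add: card_image)
qed

text \<open>
  Whether \<open>d\<close> is the element of rank \<open>j\<close> depends only on the part of the set up to \<open>d\<close>. For lengths of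
  annihilators this is what turns finite information about coefficients into knowledge of \<open>\<tau>\<^sub>j\<close>.
\<close>

lemma enumerate_eq_iff:
  fixes S :: "nat set"
  assumes "infinite S"
  shows "enumerate S j = d \<longleftrightarrow> d \<in> S \<and> card (S \<inter> {..<d}) = j"
  using assms card_less_enumerate[OF assms] by (metis enumerate_Ex enumerate_in_set)

lemma card_atMost_enumerate:
  fixes S :: "nat set"
  assumes "infinite S"
  shows "card (S \<inter> {..enumerate S j}) = Suc j"
proof -
  have "S \<inter> {..enumerate S j} = insert (enumerate S j) (S \<inter> {..<enumerate S j})"
    using enumerate_in_set[OF assms] by auto
  then show ?thesis using card_less_enumerate[OF assms] by simp
qed

lemma infinite_ann_lengths:
  fixes \<alpha> :: "'a::{field, finite} fps \<times> 'a fps"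
  shows "infinite (ann_lengths \<alpha> n)"
proof
  assume fin: "finite (ann_lengths \<alpha> n)"
  let ?c = "card (ann_lengths \<alpha> n)"
  have "card (ann_lengths \<alpha> n \<inter> {..2 * n + ?c + 1}) \<le> ?c"
    by (rule card_mono[OF fin]) auto
  then show False using card_ann_lengths_ge[of "2 * n + ?c + 1" n \<alpha>] by simp
qed

text \<open>
  The lengths in increasing order, counted from 0: in this order they are \<open>D\<^sub>n\<close>, \<open>D\<^sub>n + \<tau>\<^sub>1\<close>, \<open>D\<^sub>n + \<tau>\<^sub>2\<close>.
\<close>

abbreviation ann_length :: "'a::field fps \<times> 'a fps \<Rightarrow> nat \<Rightarrow> nat \<Rightarrow> nat" where
  "ann_length \<alpha> n j \<equiv> enumerate (ann_lengths \<alpha> n) j"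

context
  fixes \<alpha> :: "'a::{field, finite} fps \<times> 'a fps"
begin

lemma ann_length_in: "ann_length \<alpha> n j \<in> ann_lengths \<alpha> n"
  by (rule enumerate_in_set[OF infinite_ann_lengths])

lemma ann_length_less: "i < j \<Longrightarrow> ann_length \<alpha> n i < ann_length \<alpha> n j"
  by (simp add: infinite_ann_lengths)

lemma ann_length_surj:
  assumes "d \<in> ann_lengths \<alpha> n"
  obtains j where "d = ann_length \<alpha> n j"
  using enumerate_Ex[OF infinite_ann_lengths assms] that by metis

lemma ann_length_bound: "ann_length \<alpha> n j \<le> 2 * n + j + 1"
proof (rule ccontr)
  assume "\<not> ?thesis"
  then have "ann_lengths \<alpha> n \<inter> {..2 * n + j + 1} \<subseteq> ann_lengths \<alpha> n \<inter> {..<ann_length \<alpha> n j}"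
    by auto
  then have "card (ann_lengths \<alpha> n \<inter> {..2 * n + j + 1}) \<le> j"
    using card_mono[of "ann_lengths \<alpha> n \<inter> {..<ann_length \<alpha> n j}"]
      card_less_enumerate[OF infinite_ann_lengths, of \<alpha> n j] by simp
  then show False using card_ann_lengths_ge[of "2 * n + j + 1" n \<alpha>] by simp
qed

lemma ann_length_0_le: "d \<in> ann_lengths \<alpha> n \<Longrightarrow> ann_length \<alpha> n 0 \<le> d"
  by (simp add: enumerate_0 Least_le)

lemma mat_kernel_hankel_nonzero_iff:
  "mat_kernel (hankel \<alpha> n d) \<noteq> {0\<^sub>v d} \<longleftrightarrow> (\<exists>s\<in>ann_lengths \<alpha> n. s \<le> d)"
proof -
  let ?f = "\<lambda>Q :: 'a poly. vec d (coeff Q)"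
  have bij: "bij_betw ?f (short_annihilators \<alpha> n d) (mat_kernel (hankel \<alpha> n d))"
    by (rule bij_hankel_kernel)
  have 0: "0 \<in> short_annihilators \<alpha> n d" "?f 0 = 0\<^sub>v d"
    by (auto simp: short_annihilators_def)
  have "mat_kernel (hankel \<alpha> n d) = {0\<^sub>v d} \<longleftrightarrow> short_annihilators \<alpha> n d = {0}"
  proof
    assume "mat_kernel (hankel \<alpha> n d) = {0\<^sub>v d}"
    then have "?f Q = ?f 0" if "Q \<in> short_annihilators \<alpha> n d" for Q
      using bij_betw_apply[OF bij that] 0(2) by simp
    then show "short_annihilators \<alpha> n d = {0}"
      using 0(1) bij_betw_imp_inj_on[OF bij] by (auto dest: inj_onD)
  next
    assume "short_annihilators \<alpha> n d = {0}"
    then show "mat_kernel (hankel \<alpha> n d) = {0\<^sub>v d}"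
      using bij_betw_imp_surj_on[OF bij] 0(2) by simp
  qed
  also have "\<dots> \<longleftrightarrow> (\<forall>s\<in>ann_lengths \<alpha> n. \<not> s \<le> d)"
    using 0(1) by (auto simp: short_annihilators_def ann_lengths_def short_iff set_eq_iff)
  finally show ?thesis by auto
qed

lemma Dn_eq: "Dn \<alpha> n = ann_length \<alpha> n 0"
  unfolding Dn_def mat_kernel_hankel_nonzero_iff
proof (rule Least_equality)
  show "1 \<le> ann_length \<alpha> n 0 \<and> (\<exists>s\<in>ann_lengths \<alpha> n. s \<le> ann_length \<alpha> n 0)"
    using ann_length_in[of n 0] ann_lengths_ge_1 by blast
qed (use ann_length_0_le in fastforce)

lemma kernel_dim_hankel: "kernel_dim (hankel \<alpha> n d) = card (ann_lengths \<alpha> n \<inter> {..d})"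
proof -
  have H: "hankel \<alpha> n d \<in> carrier_mat (n + n) d"
    unfolding hankel_def by (rule carrier_append_rows) (auto simp: hankel_block_def)
  have "CARD('a) ^ kernel_dim (hankel \<alpha> n d) = card (mat_kernel (hankel \<alpha> n d))"
    using kernel.card_mat_kernel[OF kernel.intro[OF H]] by simp
  also have "\<dots> = card (short_annihilators \<alpha> n d)"
    using bij_betw_same_card[OF bij_hankel_kernel] by metis
  finally have "CARD('a) ^ kernel_dim (hankel \<alpha> n d) = CARD('a) ^ card (ann_lengths \<alpha> n \<inter> {..d})"
    by (simp add: card_short_annihilators)
  moreover have "CARD('a) > 1" by (rule card_field_gt_1)
  ultimately show ?thesis by simp
qed

text \<open>
  The kernel dimension increases by one at each length, so its first passage to \<open>j + 1\<close> happens at the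
  length of rank \<open>j\<close>.
\<close>

lemma tau_eq:
  assumes "j \<ge> 1"
  shows "tau \<alpha> n j = ann_length \<alpha> n j - Dn \<alpha> n"
proof -
  let ?S = "ann_lengths \<alpha> n" and ?D = "ann_length \<alpha> n 0"
  have less: "?D < ann_length \<alpha> n j" using assms by (intro ann_length_less) simp
  have "tau \<alpha> n j = (LEAST k. k \<ge> 1 \<and> card (?S \<inter> {..?D + k}) = j + 1)"
    by (simp add: tau_def nu_def kernel_dim_hankel Dn_eq Inf_nat_def)
  also have "\<dots> = ann_length \<alpha> n j - ?D"
  proof (rule Least_equality)
    show "ann_length \<alpha> n j - ?D \<ge> 1 \<and> card (?S \<inter> {..?D + (ann_length \<alpha> n j - ?D)}) = j + 1"
      using less card_atMost_enumerate[OF infinite_ann_lengths, of \<alpha> n j] by simp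
  next
    fix k assume k: "1 \<le> k \<and> card (?S \<inter> {..?D + k}) = j + 1"
    show "ann_length \<alpha> n j - ?D \<le> k"
    proof (rule ccontr)
      assume "\<not> ?thesis"
      then have "card (?S \<inter> {..?D + k}) \<le> card (?S \<inter> {..<ann_length \<alpha> n j})"
        by (intro card_mono) auto
      then show False using k card_less_enumerate[OF infinite_ann_lengths, of \<alpha> n j] by simp
    qed
  qed
  finally show ?thesis by (simp add: Dn_eq)
qed

section \<open>The jump in terms of discrepancies\<close>

lemma annihilator_eq_0:
  assumes "Q \<in> annihilators \<alpha> n" "\<And>k. Suc k \<ge> Dn \<alpha> n \<Longrightarrow> coeff Q k = 0"
  shows "Q = 0"
proof (rule ccontr)
  assume "Q \<noteq> 0"
  then have "Dn \<alpha> n \<le> Suc (degree Q)"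
    using ann_length_0_le ann_lengthsI assms(1) Dn_eq by metis
  then show False using assms(2)[of "degree Q"] \<open>Q \<noteq> 0\<close> by simp
qed

text \<open>
  Below the second length there is only one annihilator up to scalars: subtracting the right
  multiple of \<open>P\<close> makes the degree too small.
\<close>

lemma annihilator_eq_smult:
  assumes P: "P \<in> annihilators \<alpha> n" "lead_coeff P = 1" "Suc (degree P) = Dn \<alpha> n"
    and Q: "Q \<in> annihilators \<alpha> n" "\<And>k. Suc k \<ge> ann_length \<alpha> n 1 \<Longrightarrow> coeff Q k = 0"
  shows "Q = Polynomial.smult (coeff Q (degree P)) P"
proof -
  have small: "coeff Q k = 0" if "Suc k > Dn \<alpha> n" for k
  proof (cases "Q = 0")
    case False
    have in_S: "Suc (degree Q) \<in> ann_lengths \<alpha> n" using Q(1) False by (rule ann_lengthsI)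
    then obtain i where i: "Suc (degree Q) = ann_length \<alpha> n i"
      by (rule ann_length_surj)
    have "ann_length \<alpha> n i < ann_length \<alpha> n 1"
      unfolding i[symmetric] using Q(2)[of "degree Q"] False by (metis leading_coeff_0_iff not_le)
    then have "i = 0"
      using enumerate_mono_iff[OF infinite_ann_lengths, of \<alpha> n i 1] by simp
    then have "degree Q < k" using i that by (simp add: Dn_eq)
    then show ?thesis by (rule coeff_eq_0)
  qed simp
  have "Q - Polynomial.smult (coeff Q (degree P)) P = 0"
  proof (rule annihilator_eq_0[of _ n])
    show "Q - Polynomial.smult (coeff Q (degree P)) P \<in> annihilators \<alpha> n"
      by (rule annihilators_diff[OF Q(1) P(1)])
    fix k assume "Dn \<alpha> n \<le> Suc k"
    then have "degree P \<le> k" unfolding P(3)[symmetric] by simp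
    moreover have "coeff Q k = 0" "coeff P k = 0" if "degree P < k"
      using small[of k] that coeff_eq_0[OF that] unfolding P(3)[symmetric] by simp_all
    ultimately show "coeff (Q - Polynomial.smult (coeff Q (degree P)) P) k = 0"
      using P(2) by (cases "k = degree P") simp_all
  qed
  then show ?thesis by simp
qed

lemma Dn_mono: "Dn \<alpha> n \<le> Dn \<alpha> (Suc n)"
  using ann_length_in[of "Suc n" 0] ann_lengths_Suc_subset ann_length_0_le
  unfolding Dn_eq by blast

lemma Dn_Suc_eq_iff:
  assumes P: "P \<in> annihilators \<alpha> n" "lead_coeff P = 1" "Suc (degree P) = Dn \<alpha> n"
  shows "Dn \<alpha> (Suc n) = Dn \<alpha> n \<longleftrightarrow> tail_coeff \<alpha> P (Suc n) = 0"
proof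
  assume "tail_coeff \<alpha> P (Suc n) = 0"
  then have "Dn \<alpha> n \<in> ann_lengths \<alpha> (Suc n)"
    using P ann_lengthsI[of P \<alpha> "Suc n"] by (metis annihilators_Suc leading_coeff_0_iff zero_neq_one)
  then show "Dn \<alpha> (Suc n) = Dn \<alpha> n"
    using Dn_mono[of n] ann_length_0_le[of "Dn \<alpha> n" "Suc n"] by (simp add: Dn_eq)
next
  assume *: "Dn \<alpha> (Suc n) = Dn \<alpha> n"
  have "Dn \<alpha> (Suc n) \<in> ann_lengths \<alpha> (Suc n)" unfolding Dn_eq by (rule ann_length_in)
  then obtain R where R: "R \<in> annihilators \<alpha> (Suc n)" "lead_coeff R = 1" "Suc (degree R) = Dn \<alpha> (Suc n)"
    by (rule monic_annihilator)
  have "R = Polynomial.smult (coeff R (degree P)) P"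
  proof (rule annihilator_eq_smult[OF P])
    show "R \<in> annihilators \<alpha> n" using R by (simp add: annihilators_Suc)
    fix k assume "ann_length \<alpha> n 1 \<le> Suc k"
    then show "coeff R k = 0"
      using R(3) * ann_length_less[of 0 1 n] by (intro coeff_eq_0) (simp add: Dn_eq)
  qed
  then have "R = P" using R P * by (metis lead_coeff_smult mult.right_neutral smult_1_left)
  then show "tail_coeff \<alpha> P (Suc n) = 0" using R(1) by (simp add: annihilators_Suc)
qed


text \<open>
  The coefficients are the 2 by 2 minors of the three vectors; if they all vanish, the first two
  vectors are already dependent.
\<close>

lemma dependent_triple:
  fixes u v w :: "'b::field \<times> 'b"
  obtains a b c where "(a, b, c) \<noteq> (0, 0, 0)"
    "a * fst u + b * fst v + c * fst w = 0" "a * snd u + b * snd v + c * snd w = 0"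
proof -
  define a b c where
    "a = fst v * snd w - snd v * fst w" and "b = fst w * snd u - snd w * fst u" and
    "c = fst u * snd v - snd u * fst v"
  have eq: "a * fst u + b * fst v + c * fst w = 0" "a * snd u + b * snd v + c * snd w = 0"
    by (simp_all add: a_def b_def c_def algebra_simps)
  show ?thesis
  proof (cases "(a, b, c) = (0, 0, 0)")
    case False
    then show ?thesis using eq that by blast
  next
    case True
    then have c0: "fst u * snd v = snd u * fst v" by (simp add: c_def)
    show ?thesis
    proof (cases "u = 0")
      case True
      then show ?thesis using that[of 1 0 0] by simp
    next
      case False
      show ?thesis
      proof (cases "fst u = 0")
        case True
        with False have "snd u \<noteq> 0" by (simp add: prod_eq_iff)
        then show ?thesis using that[of "- snd v" "snd u" 0] True c0 by simp
      next
        case False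
        then show ?thesis using that[of "- fst v" "fst u" 0] c0 by simp
      qed
    qed
  qed
qed

text \<open>
  A nontrivial combination of three monic annihilators of different degrees is nonzero, and by
  linear dependence in the plane one of them has zero discrepancy.
\<close>

lemma Dn_Suc_le: "Dn \<alpha> (Suc n) \<le> ann_length \<alpha> n 2"
proof -
  obtain P where P: "P \<in> annihilators \<alpha> n" "lead_coeff P = 1" "Suc (degree P) = ann_length \<alpha> n 0"
    using ann_length_in by (rule monic_annihilator)
  obtain Q where Q: "Q \<in> annihilators \<alpha> n" "lead_coeff Q = 1" "Suc (degree Q) = ann_length \<alpha> n 1"
    using ann_length_in by (rule monic_annihilator)
  obtain R where R: "R \<in> annihilators \<alpha> n" "lead_coeff R = 1" "Suc (degree R) = ann_length \<alpha> n 2"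
    using ann_length_in by (rule monic_annihilator)
  have deg: "degree P < degree Q" "degree Q < degree R"
    using ann_length_less[of 0 1 n] ann_length_less[of 1 2 n] P(3) Q(3) R(3) by simp_all
  obtain a b c where abc: "(a, b, c) \<noteq> (0, 0, 0)" and
    w: "a * fst (tail_coeff \<alpha> P (Suc n)) + b * fst (tail_coeff \<alpha> Q (Suc n)) + c * fst (tail_coeff \<alpha> R (Suc n)) = 0"
       "a * snd (tail_coeff \<alpha> P (Suc n)) + b * snd (tail_coeff \<alpha> Q (Suc n)) + c * snd (tail_coeff \<alpha> R (Suc n)) = 0"
    by (rule dependent_triple)
  define Z where "Z = 0 + Polynomial.smult a P + Polynomial.smult b Q + Polynomial.smult c R"
  have "Z \<in> annihilators \<alpha> n"
    unfolding Z_def by (intro annihilators_linear zero_in_annihilators P Q R)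
  moreover have "tail_coeff \<alpha> Z (Suc n) = 0"
    unfolding Z_def by (simp only: tail_coeff_linear) (use w in \<open>simp add: zero_prod_def\<close>)
  ultimately have "Z \<in> annihilators \<alpha> (Suc n)" by (simp add: annihilators_Suc)
  moreover have "Z \<noteq> 0"
  proof
    assume "Z = 0"
    have "coeff Z (degree R) = c" using deg R(2) by (simp add: Z_def coeff_eq_0)
    then have "c = 0" using \<open>Z = 0\<close> by simp
    then have "coeff Z (degree Q) = b" using deg Q(2) by (simp add: Z_def coeff_eq_0)
    then have "b = 0" using \<open>Z = 0\<close> by simp
    with \<open>c = 0\<close> have "coeff Z (degree P) = a" using P(2) by (simp add: Z_def)
    then show False using \<open>Z = 0\<close> \<open>b = 0\<close> \<open>c = 0\<close> abc by simp
  qed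
  ultimately have "ann_length \<alpha> (Suc n) 0 \<le> Suc (degree Z)"
    by (intro ann_length_0_le ann_lengthsI)
  also have "degree Z \<le> degree R"
    unfolding Z_def using deg
    by (intro degree_add_le) (auto intro: order.trans[OF degree_smult_le])
  finally show ?thesis using R(3) by (simp add: Dn_eq)
qed

lemma Dn_Suc_cases: "\<exists>j<3. Dn \<alpha> (Suc n) = ann_length \<alpha> n j"
proof -
  have "Dn \<alpha> (Suc n) \<in> ann_lengths \<alpha> n"
    using ann_length_in[of "Suc n" 0] ann_lengths_Suc_subset[of \<alpha> n] unfolding Dn_eq by blast
  then obtain j where j: "Dn \<alpha> (Suc n) = ann_length \<alpha> n j" by (rule ann_length_surj)
  then have "\<not> 2 < j" using Dn_Suc_le[of n] ann_length_less[of 2 j n] by auto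
  then show ?thesis using j by (intro exI[of _ j]) simp
qed

text \<open>
  Up to scalars the polynomials of length \<open>\<ell>\<^sub>1\<close> at hand are \<open>Q - c P\<close>, so the question is whether some
  \<open>c\<close> cancels the discrepancy.
\<close>

lemma Dn_Suc_eq_second_iff:
  assumes P: "P \<in> annihilators \<alpha> n" "lead_coeff P = 1" "Suc (degree P) = Dn \<alpha> n"
    and Q: "Q \<in> annihilators \<alpha> n" "lead_coeff Q = 1" "Suc (degree Q) = ann_length \<alpha> n 1"
    and w: "tail_coeff \<alpha> P (Suc n) \<noteq> 0"
  shows "Dn \<alpha> (Suc n) = ann_length \<alpha> n 1 \<longleftrightarrow>
    (\<exists>c. tail_coeff \<alpha> Q (Suc n) =
      (c * fst (tail_coeff \<alpha> P (Suc n)), c * snd (tail_coeff \<alpha> P (Suc n))))" (is "_ \<longleftrightarrow> (\<exists>c. ?R c)")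
proof
  assume "\<exists>c. ?R c"
  then obtain c where c: "?R c" ..
  define Z where "Z = Q + Polynomial.smult (- c) P"
  have deg: "degree P < degree Q"
    using ann_length_less[of 0 1 n] P(3) Q(3) by (simp add: Dn_eq)
  have "Z \<in> annihilators \<alpha> (Suc n)"
    unfolding annihilators_Suc Z_def tail_coeff_linear
    using annihilators_linear[OF Q(1) P(1), of "- c"] c by (simp add: zero_prod_def)
  moreover have "degree Z = degree Q"
    unfolding Z_def using deg by (intro degree_add_eq_left) (simp split: if_splits)
  moreover have "Z \<noteq> 0" using calculation(2) deg by auto
  ultimately have "ann_length \<alpha> (Suc n) 0 \<le> ann_length \<alpha> n 1"
    using ann_length_0_le ann_lengthsI Q(3) by metis
  moreover obtain j where j: "j < 3" "Dn \<alpha> (Suc n) = ann_length \<alpha> n j" using Dn_Suc_cases by blast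
  moreover have "j \<noteq> 0" using Dn_Suc_eq_iff[OF P] w j(2) unfolding Dn_eq by metis
  moreover have "\<not> 1 < j" using ann_length_less[of 1 j n] calculation(1,3) by (auto simp: Dn_eq)
  ultimately have "j = 1" by simp
  then show "Dn \<alpha> (Suc n) = ann_length \<alpha> n 1" using j by simp
next
  assume *: "Dn \<alpha> (Suc n) = ann_length \<alpha> n 1"
  have "Dn \<alpha> (Suc n) \<in> ann_lengths \<alpha> (Suc n)" unfolding Dn_eq by (rule ann_length_in)
  then obtain R where R: "R \<in> annihilators \<alpha> (Suc n)" "lead_coeff R = 1" "Suc (degree R) = Dn \<alpha> (Suc n)"
    by (rule monic_annihilator)
  have dQR: "degree R = degree Q" using R(3) Q(3) * by simp
  define Z where "Z = Q + Polynomial.smult (- 1) R"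
  have "Z = Polynomial.smult (coeff Z (degree P)) P"
  proof (rule annihilator_eq_smult[OF P])
    show "Z \<in> annihilators \<alpha> n"
      unfolding Z_def using R(1) by (intro annihilators_linear Q) (simp add: annihilators_Suc)
    fix k assume "ann_length \<alpha> n 1 \<le> Suc k"
    then have "degree Q \<le> k" unfolding Q(3)[symmetric] by simp
    then show "coeff Z k = 0"
      using Q(2) R(2) unfolding Z_def dQR by (cases "k = degree Q") (simp_all add: coeff_eq_0 dQR)
  qed
  then have "Q = R + Polynomial.smult (coeff Z (degree P)) P" by (simp add: Z_def algebra_simps)
  then have "tail_coeff \<alpha> Q (Suc n) = tail_coeff \<alpha> (R + Polynomial.smult (coeff Z (degree P)) P) (Suc n)"
    by (rule arg_cong)
  then show "\<exists>c. ?R c" using R(1) unfolding tail_coeff_linear annihilators_Suc by auto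
qed

lemma Jn_eq_1_iff: "Jn \<alpha> n = 1 \<longleftrightarrow> Dn \<alpha> (Suc n) \<noteq> Dn \<alpha> n"
  using Dn_mono[of n] by (auto simp: Jn_def)

lemma Deltan_eq_tau_iff:
  assumes "j \<ge> 1"
  shows "Deltan \<alpha> n = int (tau \<alpha> n j) \<longleftrightarrow> Dn \<alpha> (Suc n) = ann_length \<alpha> n j"
  using ann_length_less[of 0 j n] assms by (auto simp: Deltan_def tau_eq Dn_eq)

lemma jump_index_cases:
  assumes "Jn \<alpha> n = 1" "Dn \<alpha> (Suc n) \<noteq> ann_length \<alpha> n 1"
  shows "Dn \<alpha> (Suc n) = ann_length \<alpha> n 2"
proof -
  obtain j where j: "j < 3" "Dn \<alpha> (Suc n) = ann_length \<alpha> n j" using Dn_Suc_cases by blast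
  then have "j \<noteq> 0" "j \<noteq> 1" using assms unfolding Jn_eq_1_iff Dn_eq by metis+
  then have "j = 2" using j by simp
  then show ?thesis using j by simp
qed

text \<open>
  The index is given by a definite description; it is well defined because the second and third
  lengths differ and one of them is reached.
\<close>

lemma In_eq_iff:
  assumes "j \<in> {1, 2}"
  shows "In \<alpha> n = j \<longleftrightarrow> Jn \<alpha> n = 1 \<and> Dn \<alpha> (Suc n) = ann_length \<alpha> n j"
proof (cases "Jn \<alpha> n = 1")
  case True
  have ne: "ann_length \<alpha> n 1 \<noteq> ann_length \<alpha> n 2" using ann_length_less[of 1 2 n] by simp
  let ?P = "\<lambda>j. j \<in> {1, 2} \<and> Deltan \<alpha> n = int (tau \<alpha> n j)"
  have P: "?P j \<longleftrightarrow> j \<in> {1, 2} \<and> Dn \<alpha> (Suc n) = ann_length \<alpha> n j" for j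
    using Deltan_eq_tau_iff[of j n] by auto
  have ex: "\<exists>!j. ?P j" unfolding P using jump_index_cases[OF True] ne by auto
  have "In \<alpha> n = (THE j. ?P j)" using True by (simp add: In_def)
  then have "In \<alpha> n = j \<longleftrightarrow> ?P j" using the1_equality[OF ex, of j] theI'[OF ex] by metis
  then show ?thesis using P[of j] True assms by blast
next
  case False
  then have "Jn \<alpha> n = 0" by (simp add: Jn_def split: if_splits)
  then show ?thesis using assms by (auto simp: In_def)
qed

lemma Deltan_le: "Deltan \<alpha> n \<le> 2 * int n + 3 - int (Dn \<alpha> n)"
  using ann_length_bound[of "Suc n" 0] by (simp add: Deltan_def Dn_eq)

end

section \<open>Truncated series and resampling of a coefficient\<close>

definition coeff_pair :: "'a::zero fps \<times> 'a fps \<Rightarrow> nat \<Rightarrow> 'a \<times> 'a" where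
  "coeff_pair \<alpha> j = (fps_nth (fst \<alpha>) j, fps_nth (snd \<alpha>) j)"

text \<open>
  The truncation is again a power series, with zero coefficients outside \<open>1, \<dots>, N\<close>. So every function
  of a series can be evaluated at a truncation, and an event that depends on the first \<open>N\<close> coefficients
  is one that truncation preserves. With the coefficient of index 0 set to zero, truncations lie in \<open>pp\<close>.
\<close>

definition trunc :: "nat \<Rightarrow> 'a::zero fps \<Rightarrow> 'a fps" where
  "trunc N a = Abs_fps (\<lambda>j. if j \<in> {1..N} then fps_nth a j else 0)"

definition trunc2 :: "nat \<Rightarrow> 'a::zero fps \<times> 'a fps \<Rightarrow> 'a fps \<times> 'a fps" where
  "trunc2 N = map_prod (trunc N) (trunc N)"

definition resample :: "nat \<Rightarrow> 'a \<times> 'a \<Rightarrow> 'a::zero fps \<times> 'a fps \<Rightarrow> 'a fps \<times> 'a fps" where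
  "resample s c \<alpha> =
     (Abs_fps (\<lambda>j. if j = s then fst c else fps_nth (fst \<alpha>) j),
      Abs_fps (\<lambda>j. if j = s then snd c else fps_nth (snd \<alpha>) j))"

lemma trunc_nth [simp]: "fps_nth (trunc N a) j = (if j \<in> {1..N} then fps_nth a j else 0)"
  by (simp add: trunc_def)

lemma trunc_eq_iff: "trunc N a = trunc N b \<longleftrightarrow> (\<forall>j\<in>{1..N}. fps_nth a j = fps_nth b j)"
  by (auto simp: fps_eq_iff)

lemma trunc2_eq_iff: "trunc2 N \<alpha> = trunc2 N \<beta> \<longleftrightarrow> (\<forall>j\<in>{1..N}. coeff_pair \<alpha> j = coeff_pair \<beta> j)"
  by (cases \<alpha>; cases \<beta>) (auto simp: trunc2_def trunc_eq_iff coeff_pair_def)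

lemma trunc2_eq_mono: "trunc2 N \<alpha> = trunc2 N \<beta> \<Longrightarrow> M \<le> N \<Longrightarrow> trunc2 M \<alpha> = trunc2 M \<beta>"
  by (auto simp: trunc2_eq_iff)

lemma trunc_trunc [simp]: "trunc M (trunc N a) = trunc (min M N) a"
  by (auto simp: fps_eq_iff)

lemma trunc2_trunc2 [simp]: "trunc2 M (trunc2 N \<alpha>) = trunc2 (min M N) \<alpha>"
  by (cases \<alpha>) (simp add: trunc2_def)

lemma coeff_pair_resample [simp]:
  "coeff_pair (resample s c \<alpha>) j = (if j = s then c else coeff_pair \<alpha> j)"
  by (simp add: coeff_pair_def resample_def)

lemma eq_iff_coeff_pair: "\<alpha> = \<beta> \<longleftrightarrow> (\<forall>j. coeff_pair \<alpha> j = coeff_pair \<beta> j)"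
  by (cases \<alpha>; cases \<beta>) (auto simp: coeff_pair_def fps_eq_iff)

lemma coeff_pair_trunc2 [simp]:
  "coeff_pair (trunc2 N \<alpha>) j = (if j \<in> {1..N} then coeff_pair \<alpha> j else 0)"
  by (cases \<alpha>) (simp add: coeff_pair_def trunc2_def zero_prod_def)

lemma trunc2_resample_below: "N < s \<Longrightarrow> trunc2 N (resample s c \<alpha>) = trunc2 N \<alpha>"
  by (auto simp: trunc2_eq_iff)

lemma resample_in_range:
  assumes "x \<in> range (trunc2 N)" "s \<in> {1..N}"
  shows "resample s c x \<in> range (trunc2 N)"
proof (rule range_eqI)
  have "x = trunc2 N x" using assms(1) by auto
  then have *: "coeff_pair x j = 0" if "j \<notin> {1..N}" for j
    using that by (metis coeff_pair_trunc2)
  show "resample s c x = trunc2 N (resample s c x)"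
    unfolding eq_iff_coeff_pair using * assms(2) by auto
qed

lemma resample_resample_self: "resample s (coeff_pair x s) (resample s c x) = x"
  by (simp add: eq_iff_coeff_pair)

lemma finite_range_trunc: "finite (range (trunc N :: 'a::{zero, finite} fps \<Rightarrow> 'a fps))"
proof (rule finite_surj)
  show "finite ({1..N} \<rightarrow>\<^sub>E (UNIV :: 'a set))" by (rule finite_PiE) auto
  show "range (trunc N :: 'a fps \<Rightarrow> 'a fps)
      \<subseteq> (\<lambda>f. Abs_fps (\<lambda>j. if j \<in> {1..N} then f j else 0)) ` ({1..N} \<rightarrow>\<^sub>E UNIV)"
  proof clarify
    fix a :: "'a fps"
    show "trunc N a \<in> (\<lambda>f. Abs_fps (\<lambda>j. if j \<in> {1..N} then f j else 0)) ` ({1..N} \<rightarrow>\<^sub>E UNIV)"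
      by (rule image_eqI[of _ _ "restrict (fps_nth a) {1..N}"]) (auto simp: fps_eq_iff)
  qed
qed

lemma range_trunc2: "range (trunc2 N) = range (trunc N) \<times> range (trunc N)"
  by (auto simp: trunc2_def image_iff)

lemma finite_range_trunc2 [simp]: "finite (range (trunc2 N :: 'a::{zero, finite} fps \<times> 'a fps \<Rightarrow> _))"
  by (simp add: range_trunc2 finite_range_trunc)

text \<open>
  The fresh coefficient principle. The index \<open>s x\<close> of the resampled pair may depend on \<open>x\<close>, but not on
  the pair stored at that index. Then exchanging the stored pair with a new one is an involution on
  configurations with an extra pair, which preserves the uniform distribution; so \<open>E\<close> has the size
  predicted by treating the pair of index \<open>s x\<close> as uniform given all the others.
\<close>

lemma card_by_resampling:
  fixes E B :: "('a::{zero, finite} fps \<times> 'a fps) set"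
  assumes s: "\<And>x. x \<in> range (trunc2 N) \<Longrightarrow> s x \<in> {1..N}"
    and stop: "\<And>x c. x \<in> range (trunc2 N) \<Longrightarrow> s (resample (s x) c x) = s x"
    and E: "E \<subseteq> range (trunc2 N)" and B: "B \<subseteq> range (trunc2 N)"
    and m: "\<And>x. x \<in> range (trunc2 N) \<Longrightarrow>
              card {c. resample (s x) c x \<in> E} = (if x \<in> B then m else 0)"
  shows "CARD('a)\<^sup>2 * card E = m * card B"
proof -
  let ?X = "range (trunc2 N :: 'a fps \<times> 'a fps \<Rightarrow> _)"
  let ?pairs = "SIGMA x:?X. {c. resample (s x) c x \<in> E}"
  let ?f = "\<lambda>(x, c). (resample (s x) c x, coeff_pair x (s x))"
  have X: "resample (s x) c x \<in> ?X" if "x \<in> ?X" for x c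
    using that s resample_in_range by blast
  have inv: "?f (?f p) = p" if "fst p \<in> ?X" for p
    using that stop by (cases p) (auto simp: resample_resample_self)
  have "bij_betw ?f ?pairs (E \<times> UNIV)"
  proof (rule bij_betwI[where g = ?f])
    show "?f \<in> ?pairs \<rightarrow> E \<times> UNIV" by auto
    show "?f \<in> E \<times> UNIV \<rightarrow> ?pairs"
    proof
      fix p :: "('a fps \<times> 'a fps) \<times> 'a \<times> 'a" assume "p \<in> E \<times> UNIV"
      then obtain x c where p: "p = (x, c)" "x \<in> E" "x \<in> ?X" using E by blast
      then show "?f p \<in> ?pairs"
        using X[of x c] stop[of x c] by (simp add: resample_resample_self)
    qed
    show "?f (?f p) = p" if "p \<in> ?pairs" for p using that by (intro inv) auto
    show "?f (?f p) = p" if "p \<in> E \<times> UNIV" for p using that E by (intro inv) auto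
  qed
  then have "card E * card (UNIV :: ('a \<times> 'a) set) = card ?pairs"
    by (simp add: bij_betw_same_card card_cartesian_product)
  also have "\<dots> = (\<Sum>x\<in>?X. card {c. resample (s x) c x \<in> E})" by (rule card_SigmaI) auto
  also have "\<dots> = (\<Sum>x\<in>?X. if x \<in> B then m else 0)" by (rule sum.cong) (auto simp only: m)
  also have "\<dots> = (\<Sum>x\<in>B. m)" using B by (simp add: sum.If_cases Int_absorb2 Int_absorb1)
  finally show ?thesis
    by (simp add: card_cartesian_product power2_eq_square mult_ac flip: UNIV_Times_UNIV)
qed

section \<open>Which coefficients determine the lengths\<close>

lemma tail_coeff_conv:
  "tail_coeff \<alpha> Q m =
    (\<Sum>k\<le>degree Q. coeff Q k * fst (coeff_pair \<alpha> (m + k)),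
     \<Sum>k\<le>degree Q. coeff Q k * snd (coeff_pair \<alpha> (m + k)))"
  by (simp add: tail_coeff_def coeff_pair_def)

lemma tail_coeff_cong:
  assumes "trunc2 N \<alpha> = trunc2 N \<beta>" "1 \<le> m" "m + degree Q \<le> N"
  shows "tail_coeff \<alpha> Q m = tail_coeff \<beta> Q m"
proof -
  have "coeff_pair \<alpha> (m + k) = coeff_pair \<beta> (m + k)" if "k \<le> degree Q" for k
    using assms that by (auto simp: trunc2_eq_iff)
  then show ?thesis by (simp add: tail_coeff_conv)
qed

lemma annihilators_cong:
  assumes "trunc2 N \<alpha> = trunc2 N \<beta>" "n + degree Q \<le> N"
  shows "Q \<in> annihilators \<alpha> n \<longleftrightarrow> Q \<in> annihilators \<beta> n"
  using tail_coeff_cong[OF assms(1), of _ Q] assms(2) by (simp add: annihilators_def)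

lemma ann_lengths_cong:
  assumes "trunc2 N \<alpha> = trunc2 N \<beta>" "n + d \<le> Suc N"
  shows "d \<in> ann_lengths \<alpha> n \<longleftrightarrow> d \<in> ann_lengths \<beta> n"
  using annihilators_cong[OF assms(1), of n] assms(2) by (auto simp: ann_lengths_def)

text \<open>
  Annihilators of length at most \<open>d\<close> and level \<open>n\<close> involve the coefficients up to index \<open>n + d - 1\<close> only,
  which is just short of the index resampled later.
\<close>

lemma ann_length_cong:
  fixes \<alpha> \<beta> :: "'a::{field, finite} fps \<times> 'a fps"
  assumes "trunc2 N \<alpha> = trunc2 N \<beta>" "n + ann_length \<alpha> n j \<le> Suc N"
  shows "ann_length \<beta> n j = ann_length \<alpha> n j"
proof -
  let ?d = "ann_length \<alpha> n j"
  have *: "d \<in> ann_lengths \<alpha> n \<longleftrightarrow> d \<in> ann_lengths \<beta> n" if "d \<le> ?d" for d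
    using assms that by (intro ann_lengths_cong[of N]) auto
  then have "ann_lengths \<beta> n \<inter> {..<?d} = ann_lengths \<alpha> n \<inter> {..<?d}" by auto
  moreover have "?d \<in> ann_lengths \<beta> n" using *[of ?d] ann_length_in[of \<alpha> n j] by simp
  ultimately show ?thesis
    by (simp add: enumerate_eq_iff[OF infinite_ann_lengths] card_less_enumerate[OF infinite_ann_lengths])
qed

text \<open>
  The pair of index \<open>m + degree Q\<close> meets only the leading coefficient of \<open>Q\<close>.
\<close>

lemma tail_coeff_resample:
  assumes "1 \<le> m"
  shows "tail_coeff (resample (m + degree Q) c \<alpha>) Q m =
    (fst (tail_coeff \<alpha> Q m) + lead_coeff Q * (fst c - fst (coeff_pair \<alpha> (m + degree Q))),
     snd (tail_coeff \<alpha> Q m) + lead_coeff Q * (snd c - snd (coeff_pair \<alpha> (m + degree Q))))"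
proof -
  have "(\<Sum>k\<le>degree Q. f k) = (\<Sum>k<degree Q. f k) + f (degree Q)" for f :: "nat \<Rightarrow> 'a"
    by (simp flip: lessThan_Suc_atMost)
  then show ?thesis by (simp add: tail_coeff_conv algebra_simps)
qed

section \<open>Counting coefficient arrays\<close>

lemma card_affine_image:
  fixes u w :: "'a::{field, finite} \<times> 'a"
  assumes "w \<noteq> 0"
  shows "card (range (\<lambda>l. (l * fst w + fst u, l * snd w + snd u))) = CARD('a)"
  using assms by (intro card_image) (auto simp: inj_on_def prod_eq_iff)

text \<open>
  At each level the pair of index \<open>n + 1 + degree Q\<close> is fresh and has exactly one value for which the
  discrepancy of \<open>Q\<close> vanishes.
\<close>

lemma card_annihilated:
  fixes Q :: "'a::{field, finite} poly"
  assumes "Q \<noteq> 0" "n + degree Q \<le> N"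
  shows "CARD('a) ^ (2 * n) * card {x \<in> range (trunc2 N). Q \<in> annihilators x n} =
    card (range (trunc2 N :: 'a fps \<times> 'a fps \<Rightarrow> _))"
  using assms(2)
proof (induction n)
  case 0
  have "{x \<in> range (trunc2 N). Q \<in> annihilators x 0} = range (trunc2 N)"
    by (auto simp: annihilators_def)
  then show ?case by simp
next
  case (Suc n)
  let ?s = "Suc n + degree Q" and ?l = "lead_coeff Q"
  let ?E = "\<lambda>n. {x \<in> range (trunc2 N). Q \<in> annihilators x n}"
  have "CARD('a)\<^sup>2 * card (?E (Suc n)) = 1 * card (?E n)"
  proof (rule card_by_resampling[where s = "\<lambda>_. ?s" and N = N])
    fix x :: "'a fps \<times> 'a fps" assume x: "x \<in> range (trunc2 N)"
    show "?s \<in> {1..N}" using Suc.prems by simp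
    have ann: "Q \<in> annihilators (resample ?s c x) n \<longleftrightarrow> Q \<in> annihilators x n" for c
      by (rule annihilators_cong[where N = "n + degree Q"]) (simp_all add: trunc2_resample_below)
    have rng: "resample ?s c x \<in> range (trunc2 N)" for c
      using x Suc.prems by (intro resample_in_range) auto
    \<comment> \<open>The only value of the pair that makes the discrepancy vanish.\<close>
    define c0 where "c0 = (fst (coeff_pair x ?s) - fst (tail_coeff x Q (Suc n)) / ?l,
                           snd (coeff_pair x ?s) - snd (tail_coeff x Q (Suc n)) / ?l)"
    have "tail_coeff (resample ?s c x) Q (Suc n) = 0 \<longleftrightarrow> c = c0" for c
      using assms(1) by (simp only: tail_coeff_resample) (auto simp: c0_def prod_eq_iff field_simps)
    then have "{c. resample ?s c x \<in> ?E (Suc n)} = (if x \<in> ?E n then {c0} else {})"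
      using x rng ann by (auto simp: annihilators_Suc)
    then show "card {c. resample ?s c x \<in> ?E (Suc n)} = (if x \<in> ?E n then 1 else 0)"
      by simp
  qed auto
  then have "CARD('a) ^ (2 * Suc n) * card (?E (Suc n)) = CARD('a) ^ (2 * n) * card (?E n)"
    by (simp add: power2_eq_square mult_ac)
  also have "\<dots> = card (range (trunc2 N :: 'a fps \<times> 'a fps \<Rightarrow> _))" using Suc by simp
  finally show ?case .
qed

text \<open>
  First moment bound: sum over \<open>x\<close> the number of nonzero annihilators of degree less than \<open>d\<close>, which is
  at least \<open>q - 1\<close> whenever \<open>D\<^sub>n \<le> d\<close>, and exchange the sums.
\<close>

lemma card_Dn_le:
  fixes n d N :: nat
  assumes "n + d \<le> Suc N"
  defines "X \<equiv> range (trunc2 N :: 'a::{field, finite} fps \<times> 'a fps \<Rightarrow> _)"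
  shows "(CARD('a) - 1) * CARD('a) ^ (2 * n) * card {x \<in> X. Dn x n \<le> d} \<le> CARD('a) ^ d * card X"
proof -
  let ?q = "CARD('a)"
  let ?D = "{x \<in> X. Dn x n \<le> d}"
  let ?V = "{Q :: 'a poly. \<forall>k\<ge>d. coeff Q k = 0} - {0}"
  have X: "finite X" by (simp add: X_def)
  have V: "finite ?V" "card ?V \<le> ?q ^ d"
    using card_polys_of_bounded_degree[of d, where 'a = 'a]
    by (auto intro: order.trans[OF card_Diff1_le])
  have lower: "?q - 1 \<le> card {Q \<in> ?V. Q \<in> annihilators x n}" if "x \<in> ?D" for x
  proof -
    have "1 \<le> card (ann_lengths x n \<inter> {..d})"
      using that ann_length_in[of x n 0] by (auto simp: Dn_eq Suc_le_eq card_gt_0_iff)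
    then have "?q \<le> card (short_annihilators x n d)"
      unfolding card_short_annihilators by (intro self_le_power) auto
    moreover have "{Q \<in> ?V. Q \<in> annihilators x n} = short_annihilators x n d - {0}"
      by (auto simp: short_annihilators_def)
    ultimately show ?thesis by (simp add: card_Diff_singleton short_annihilators_def)
  qed
  have "?q ^ (2 * n) * ((?q - 1) * card ?D) \<le> ?q ^ (2 * n) * (\<Sum>x\<in>?D. card {Q \<in> ?V. Q \<in> annihilators x n})"
  proof (rule mult_left_mono)
    have "(?q - 1) * card ?D = (\<Sum>x\<in>?D. ?q - 1)" by simp
    also have "\<dots> \<le> (\<Sum>x\<in>?D. card {Q \<in> ?V. Q \<in> annihilators x n})"
      by (rule sum_mono) (rule lower)
    finally show "(?q - 1) * card ?D \<le> (\<Sum>x\<in>?D. card {Q \<in> ?V. Q \<in> annihilators x n})" .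
  qed simp
  also have "\<dots> \<le> ?q ^ (2 * n) * (\<Sum>x\<in>X. card {Q \<in> ?V. Q \<in> annihilators x n})"
    using X by (intro mult_left_mono sum_mono2) auto
  also have "(\<Sum>x\<in>X. card {Q \<in> ?V. Q \<in> annihilators x n}) =
      (\<Sum>Q\<in>?V. card {x \<in> X. Q \<in> annihilators x n})"
    by (rule sum_multicount_gen) (use X V in auto)
  also have "?q ^ (2 * n) * \<dots> = (\<Sum>Q\<in>?V. card X)"
    unfolding sum_distrib_left
  proof (rule sum.cong[OF refl])
    fix Q assume "Q \<in> ?V"
    then have "Q \<noteq> 0" "n + degree Q \<le> N" using assms(1) by (auto simp: short_iff)
    then show "?q ^ (2 * n) * card {x \<in> X. Q \<in> annihilators x n} = card X"
      unfolding X_def by (rule card_annihilated)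
  qed
  also have "\<dots> \<le> ?q ^ d * card X" using V(2) by simp
  finally show ?thesis by (simp add: mult_ac)
qed


text \<open>
  Agreement of two series up to index \<open>n + D\<^sub>n\<close> is agreement up to the stopping time \<open>T\<^sub>n + 1\<close>. One of
  these coefficients is needed beyond those that determine \<open>D\<^sub>n\<close>, to see the discrepancy of the shortest
  annihilator, and with it the jump.
\<close>

context
  fixes \<alpha> \<beta> :: "'a::{field, finite} fps \<times> 'a fps" and n :: nat
  assumes agree: "trunc2 (n + Dn \<alpha> n) \<alpha> = trunc2 (n + Dn \<alpha> n) \<beta>"
begin

lemma Dn_stopped: "Dn \<beta> n = Dn \<alpha> n"
  unfolding Dn_eq by (rule ann_length_cong[OF agree]) (simp add: Dn_eq)

lemma tail_coeff_stopped:
  "Suc (degree P) = Dn \<alpha> n \<Longrightarrow> tail_coeff \<beta> P (Suc n) = tail_coeff \<alpha> P (Suc n)"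
  by (rule tail_coeff_cong[OF agree[symmetric]]) auto

lemma annihilator_stopped:
  "Suc (degree P) = Dn \<alpha> n \<Longrightarrow> P \<in> annihilators \<beta> n \<longleftrightarrow> P \<in> annihilators \<alpha> n"
  by (rule annihilators_cong[OF agree[symmetric]]) auto

lemma Jn_stopped: "Jn \<beta> n = 1 \<longleftrightarrow> Jn \<alpha> n = 1"
proof -
  have "Dn \<alpha> n \<in> ann_lengths \<alpha> n" unfolding Dn_eq by (rule ann_length_in)
  then obtain P where P: "P \<in> annihilators \<alpha> n" "lead_coeff P = 1" "Suc (degree P) = Dn \<alpha> n"
    by (rule monic_annihilator)
  have P': "P \<in> annihilators \<beta> n" "Suc (degree P) = Dn \<beta> n"
    using P annihilator_stopped Dn_stopped by simp_all
  show ?thesis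
    unfolding Jn_eq_1_iff Dn_Suc_eq_iff[OF P] Dn_Suc_eq_iff[OF P'(1) P(2) P'(2)]
    by (simp add: tail_coeff_stopped P)
qed

end

text \<open>
  The discrepancy of the shortest annihilator is governed by the pair of index \<open>n + D\<^sub>n\<close>, which does not
  influence \<open>D\<^sub>n\<close>. Exactly one of the \<open>q\<^sup>2\<close> values of the pair prevents a jump.
\<close>

lemma card_jump:
  fixes n d N :: nat
  assumes N: "3 * n + 1 \<le> N"
  defines "X \<equiv> range (trunc2 N :: 'a::{field, finite} fps \<times> 'a fps \<Rightarrow> _)"
  shows "CARD('a)\<^sup>2 * card {x \<in> X. Dn x n \<le> d \<and> Jn x n = 1} =
    (CARD('a)\<^sup>2 - 1) * card {x \<in> X. Dn x n \<le> d}"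
proof (rule card_by_resampling[where s = "\<lambda>x. n + Dn x n" and N = N])
  fix x :: "'a fps \<times> 'a fps" assume x: "x \<in> range (trunc2 N)"
  let ?s = "n + Dn x n"
  have "Dn x n \<in> ann_lengths x n" unfolding Dn_eq by (rule ann_length_in)
  then obtain P where P: "P \<in> annihilators x n" "lead_coeff P = 1" "Suc (degree P) = Dn x n"
    by (rule monic_annihilator)
  have s: "?s = Suc n + degree P" using P(3) by simp
  show "?s \<in> {1..N}" using ann_length_bound[of x n 0] N P(3) by (simp add: Dn_eq)
  then have rng: "resample ?s c x \<in> X" for c
    using x unfolding X_def by (intro resample_in_range)
  have below: "trunc2 (n + degree P) (resample ?s c x) = trunc2 (n + degree P) x" for c
    by (rule trunc2_resample_below) (simp add: s)
  have D: "Dn (resample ?s c x) n = Dn x n" for c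
    using ann_length_cong[OF below[of c, symmetric], of n 0] P(3) unfolding Dn_eq by linarith
  show "n + Dn (resample ?s c x) n = ?s" for c by (simp add: D)
  have ann: "P \<in> annihilators (resample ?s c x) n" for c
    using annihilators_cong[OF below, of n P] P(1) by simp
  have J: "Jn (resample ?s c x) n = 1 \<longleftrightarrow> tail_coeff (resample ?s c x) P (Suc n) \<noteq> 0" for c
    unfolding Jn_eq_1_iff using Dn_Suc_eq_iff[OF ann P(2)] D P(3) by metis
  define c0 where "c0 = coeff_pair x ?s - tail_coeff x P (Suc n)"
  have "tail_coeff (resample ?s c x) P (Suc n) = 0 \<longleftrightarrow> c = c0" for c
    using P(2) unfolding s c0_def by (simp only: tail_coeff_resample) (auto simp: prod_eq_iff algebra_simps)
  then have "{c. resample ?s c x \<in> {x \<in> X. Dn x n \<le> d \<and> Jn x n = 1}} =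
      (if x \<in> {x \<in> X. Dn x n \<le> d} then UNIV - {c0} else {})"
    using x rng D J unfolding X_def by auto
  then show "card {c. resample ?s c x \<in> {x \<in> X. Dn x n \<le> d \<and> Jn x n = 1}} =
      (if x \<in> {x \<in> X. Dn x n \<le> d} then CARD('a)\<^sup>2 - 1 else 0)"
    by (simp add: card_Diff_singleton power2_eq_square)
qed (auto simp: X_def)

text \<open>
  The heart of the matter. The set \<open>A\<close> stands for an event known at time \<open>n + D\<^sub>n\<close>; the pair of index
  \<open>n + \<ell>\<^sub>1\<close> comes strictly later and shifts the discrepancy of the second annihilator, which has to hit
  one of the \<open>q\<close> points of a line.
\<close>

lemma card_first_index:
  fixes n N :: nat and A :: "('a::{field, finite} fps \<times> 'a fps) set"
  assumes N: "3 * n + 2 \<le> N" and A: "A \<subseteq> range (trunc2 N)"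
    and stopped: "\<And>x y. x \<in> A \<Longrightarrow> y \<in> range (trunc2 N) \<Longrightarrow>
                    trunc2 (n + Dn x n) x = trunc2 (n + Dn x n) y \<Longrightarrow> y \<in> A"
  shows "CARD('a) * card {x \<in> A. In x n = 1} = card {x \<in> A. Jn x n = 1}"
proof -
  have "CARD('a)\<^sup>2 * card {x \<in> A. In x n = 1} = CARD('a) * card {x \<in> A. Jn x n = 1}"
  proof (rule card_by_resampling[where s = "\<lambda>x. n + ann_length x n 1" and N = N])
    fix x :: "'a fps \<times> 'a fps" assume x: "x \<in> range (trunc2 N)"
    let ?s = "n + ann_length x n 1"
    let ?y = "\<lambda>c. resample ?s c x"
    have "Dn x n \<in> ann_lengths x n" unfolding Dn_eq by (rule ann_length_in)
    then obtain P where P: "P \<in> annihilators x n" "lead_coeff P = 1" "Suc (degree P) = Dn x n"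
      by (rule monic_annihilator)
    obtain Q where Q: "Q \<in> annihilators x n" "lead_coeff Q = 1" "Suc (degree Q) = ann_length x n 1"
      using ann_length_in by (rule monic_annihilator)
    have less: "Dn x n < ann_length x n 1" unfolding Dn_eq by (rule ann_length_less) simp
    have s: "?s = Suc n + degree Q" using Q(3) by simp
    show "?s \<in> {1..N}" using ann_length_bound[of x n 1] N Q(3) by simp
    then have rng: "?y c \<in> range (trunc2 N)" for c
      using x by (intro resample_in_range)
    have below: "trunc2 (n + degree Q) x = trunc2 (n + degree Q) (?y c)" for c
      by (rule trunc2_resample_below[symmetric]) (use Q(3) in linarith)
    have agree: "trunc2 (n + Dn x n) x = trunc2 (n + Dn x n) (?y c)" for c
      by (rule trunc2_eq_mono[OF below]) (use less Q(3) in simp)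
    have L: "ann_length (?y c) n 1 = ann_length x n 1" for c
      by (rule ann_length_cong[OF below]) (use Q(3) in simp)
    show "n + ann_length (?y c) n 1 = ?s" for c by (simp only: L)
    have D: "Dn (?y c) n = Dn x n" for c by (rule Dn_stopped[OF agree])
    have J: "Jn (?y c) n = 1 \<longleftrightarrow> Jn x n = 1" for c by (rule Jn_stopped[OF agree])
    have memA: "?y c \<in> A \<longleftrightarrow> x \<in> A" for c
    proof
      assume "x \<in> A"
      then show "?y c \<in> A" using rng agree by (rule stopped)
    next
      assume "?y c \<in> A"
      then show "x \<in> A" using x by (rule stopped) (use agree[of c] in \<open>simp only: D\<close>)
    qed
    let ?w = "tail_coeff x P (Suc n)" and ?v = "tail_coeff x Q (Suc n)"
    \<comment> \<open>The resampled value \<open>c\<close> gives \<open>Q\<close> the discrepancy \<open>c - u\<close>.\<close>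
    define u where "u = coeff_pair x ?s - ?v"
    have count: "card {c. In (?y c) n = 1} = CARD('a)" if J1: "Jn x n = 1"
    proof -
      have w: "?w \<noteq> 0" using J1 unfolding Jn_eq_1_iff Dn_Suc_eq_iff[OF P] .
      have "In (?y c) n = 1 \<longleftrightarrow> c \<in> range (\<lambda>l. (l * fst ?w + fst u, l * snd ?w + snd u))" for c
      proof -
        have P': "P \<in> annihilators (?y c) n" "Suc (degree P) = Dn (?y c) n"
          using P annihilator_stopped[OF agree] D by simp_all
        have Q': "Q \<in> annihilators (?y c) n" "Suc (degree Q) = ann_length (?y c) n 1"
          using Q annihilators_cong[OF below, of n Q] L by simp_all
        have w': "tail_coeff (?y c) P (Suc n) = ?w"
          by (rule tail_coeff_stopped[OF agree P(3)])
        have v': "tail_coeff (?y c) Q (Suc n) = ?v + (c - coeff_pair x ?s)"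
          unfolding s by (subst tail_coeff_resample) (simp_all add: Q(2) prod_eq_iff)
        have "In (?y c) n = 1 \<longleftrightarrow> Dn (?y c) (Suc n) = ann_length (?y c) n 1"
          using In_eq_iff[of 1 "?y c" n] J[of c] J1 by simp
        also have "\<dots> \<longleftrightarrow> (\<exists>l. ?v + (c - coeff_pair x ?s) = (l * fst ?w, l * snd ?w))"
          using Dn_Suc_eq_second_iff[OF P'(1) P(2) P'(2) Q'(1) Q(2) Q'(2)] w unfolding w' v' by simp
        also have "\<dots> \<longleftrightarrow> c \<in> range (\<lambda>l. (l * fst ?w + fst u, l * snd ?w + snd u))"
          by (auto simp: u_def prod_eq_iff image_iff algebra_simps)
        finally show ?thesis .
      qed
      then have "{c. In (?y c) n = 1} = range (\<lambda>l. (l * fst ?w + fst u, l * snd ?w + snd u))"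
        by blast
      then show ?thesis using card_affine_image[OF w] by simp
    qed
    have none: "In (?y c) n \<noteq> 1" if "Jn x n \<noteq> 1" for c
      using In_eq_iff[of 1 "?y c" n] J[of c] that by simp
    show "card {c. ?y c \<in> {x \<in> A. In x n = 1}} = (if x \<in> {x \<in> A. Jn x n = 1} then CARD('a) else 0)"
      using memA count none by (cases "x \<in> A"; cases "Jn x n = 1") simp_all
  qed (use A in auto)
  then show ?thesis by (simp add: power2_eq_square)
qed

section \<open>The coefficients of a Haar random series\<close>

lemma mem_pp_iff: "f \<in> pp \<longleftrightarrow> fps_nth f 0 = 0"
proof
  assume "fps_nth f 0 = 0"
  then have "f = fps_X * fps_shift 1 f" by (simp add: fps_eq_iff)
  then show "f \<in> pp" unfolding pp_def by blast
qed (auto simp: pp_def)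

lemma open_trunc_fibre: "open {f :: 'a::field fps. trunc N f = c}"
proof (subst open_subopen, rule ballI)
  fix f :: "'a fps" assume f: "f \<in> {f. trunc N f = c}"
  let ?U = "{H. fps_cutoff (Suc N) H = fps_cutoff (Suc N) f}"
  have "?U \<subseteq> {f. trunc N f = c}"
    using f unfolding fps_cutoff_eq_fps_cutoff_iff
    by (auto simp: trunc_eq_iff less_Suc_eq_le)
  then show "\<exists>T. open T \<and> f \<in> T \<and> T \<subseteq> {f. trunc N f = c}"
    using open_fps_cutoff[of "Suc N" f] by blast
qed

lemma space_borel_pp [simp]: "space borel_pp = pp"
  by (simp add: borel_pp_def space_restrict_space)

lemma trunc_fibre_sets: "{f \<in> pp. trunc N f = c} \<in> sets borel_pp"
  unfolding borel_pp_def sets_restrict_space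
  using open_trunc_fibre[of N c] by (intro image_eqI[of _ _ "{f. trunc N f = c}"]) auto

lemma measurable_translation:
  assumes "c \<in> pp"
  shows "(\<lambda>x. c + x) \<in> borel_pp \<rightarrow>\<^sub>M borel_pp"
proof -
  have "continuous_on UNIV (\<lambda>x :: 'a fps. c + x)"
    unfolding continuous_on_iff by (auto simp: dist_fps_def)
  then have "(\<lambda>x. c + x) \<in> borel \<rightarrow>\<^sub>M borel" by (rule borel_measurable_continuous_onI)
  then show ?thesis
    unfolding borel_pp_def using assms
    by (intro measurable_restrict_space2 measurable_restrict_space1)
       (auto simp: space_restrict_space mem_pp_iff)
qed

text \<open>
  Translations permute the cylinders of a given level transitively, so an invariant probability gives
  them equal mass.
\<close>

lemma haar_trunc_uniform:
  fixes \<mu> :: "'a::{field, finite} fps measure"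
  assumes haar: "haar_prob_measure \<mu>" and c: "c \<in> range (trunc N)"
  shows "measure \<mu> {f \<in> pp. trunc N f = c} = 1 / card (range (trunc N :: 'a fps \<Rightarrow> 'a fps))"
proof -
  interpret prob_space \<mu> using haar by (simp add: haar_prob_measure_def)
  have sets: "sets \<mu> = sets borel_pp" using haar by (simp add: haar_prob_measure_def)
  then have space: "space \<mu> = pp" using sets_eq_imp_space_eq[OF sets] by simp
  let ?C = "\<lambda>c. {f \<in> pp. trunc N f = c}" and ?X = "range (trunc N :: 'a fps \<Rightarrow> 'a fps)"
  have inv: "measure \<mu> (?C c) = measure \<mu> (?C 0)" if "c \<in> ?X" for c
  proof -
    have c: "- c \<in> pp" "trunc N c = c" using that by (auto simp: mem_pp_iff)
    have "measure \<mu> (?C 0) = measure (distr \<mu> \<mu> (\<lambda>x. - c + x)) (?C 0)"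
    proof -
      have "distr \<mu> \<mu> (\<lambda>x. - c + x) = \<mu>"
        using haar c(1) unfolding haar_prob_measure_def by blast
      then show ?thesis by (simp only:)
    qed
    also have "\<dots> = measure \<mu> ((\<lambda>x. - c + x) -` ?C 0 \<inter> space \<mu>)"
      using measurable_translation[OF c(1)] trunc_fibre_sets
      by (intro measure_distr) (simp_all add: sets cong: measurable_cong_sets)
    also have "(\<lambda>x. - c + x) -` ?C 0 \<inter> space \<mu> = ?C c"
    proof -
      have "trunc N (- c + f) = trunc N f - trunc N c" for f
        by (simp add: fps_eq_iff)
      then have "trunc N (- c + f) = 0 \<longleftrightarrow> trunc N f = c" for f
        by (simp add: c(2))
      then show ?thesis using c(1) by (auto simp: space mem_pp_iff)
    qed
    finally show ?thesis by simp
  qed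
  have "(\<Union>c\<in>?X. ?C c) = space \<mu>" by (auto simp: space)
  then have "1 = measure \<mu> (\<Union>c\<in>?X. ?C c)" by (simp only: prob_space)
  also have "\<dots> = (\<Sum>c\<in>?X. measure \<mu> (?C c))"
    by (rule finite_measure_finite_Union) (auto simp: finite_range_trunc sets trunc_fibre_sets disjoint_family_on_def)
  also have "\<dots> = card ?X * measure \<mu> (?C 0)" using inv by simp
  finally have "card ?X * measure \<mu> (?C c) = 1" using inv[OF c] by simp
  moreover have "card ?X > 0" by (simp add: card_gt_0_iff finite_range_trunc)
  ultimately show ?thesis by (simp add: field_simps)
qed

locale haar_pair = prob_space M for M :: "'w measure" +
  fixes \<alpha>\<^sub>1 \<alpha>\<^sub>2 :: "'w \<Rightarrow> 'a::{field, finite} fps"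
  assumes haar1: "haar_random M \<alpha>\<^sub>1" and haar2: "haar_random M \<alpha>\<^sub>2"
    and indep: "indep_var borel_pp \<alpha>\<^sub>1 borel_pp \<alpha>\<^sub>2"
begin

definition \<alpha> :: "'w \<Rightarrow> 'a fps \<times> 'a fps" where "\<alpha> \<omega> = (\<alpha>\<^sub>1 \<omega>, \<alpha>\<^sub>2 \<omega>)"

lemma trunc2_alpha: "trunc2 N (\<alpha> \<omega>) = (trunc N (\<alpha>\<^sub>1 \<omega>), trunc N (\<alpha>\<^sub>2 \<omega>))"
  by (simp add: \<alpha>_def trunc2_def)

lemma haar_random_fibre:
  fixes X :: "'w \<Rightarrow> 'a fps"
  assumes "haar_random M X" "c \<in> range (trunc N)"
  shows "prob (X -` {f \<in> pp. trunc N f = c} \<inter> space M) = 1 / card (range (trunc N :: 'a fps \<Rightarrow> 'a fps))"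
proof -
  have "X \<in> M \<rightarrow>\<^sub>M borel_pp" "haar_prob_measure (distr M borel_pp X)"
    using assms by (auto simp: haar_random_def)
  then show ?thesis
    using haar_trunc_uniform[of "distr M borel_pp X" c N] assms(2)
    by (simp add: measure_distr trunc_fibre_sets)
qed

lemma trunc2_fibre:
  "{\<omega> \<in> space M. trunc2 N (\<alpha> \<omega>) = x} \<in> events" (is ?A)
  "x \<in> range (trunc2 N) \<Longrightarrow>
     prob {\<omega> \<in> space M. trunc2 N (\<alpha> \<omega>) = x} = 1 / card (range (trunc2 N :: 'a fps \<times> 'a fps \<Rightarrow> _))"
proof -
  let ?C = "\<lambda>c. {f \<in> pp. trunc N f = c}"
  have meas: "\<alpha>\<^sub>1 \<in> M \<rightarrow>\<^sub>M borel_pp" "\<alpha>\<^sub>2 \<in> M \<rightarrow>\<^sub>M borel_pp"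
    using haar1 haar2 by (auto simp: haar_random_def)
  have pp: "\<alpha>\<^sub>1 \<omega> \<in> pp" "\<alpha>\<^sub>2 \<omega> \<in> pp" if "\<omega> \<in> space M" for \<omega>
    using that meas[THEN measurable_space] by auto
  have eq: "{\<omega> \<in> space M. trunc2 N (\<alpha> \<omega>) = x} =
      (\<alpha>\<^sub>1 -` ?C (fst x) \<inter> space M) \<inter> (\<alpha>\<^sub>2 -` ?C (snd x) \<inter> space M)"
    using pp by (auto simp: trunc2_alpha)
  show ?A
    unfolding eq using meas trunc_fibre_sets by (intro sets.Int measurable_sets) auto
  assume x: "x \<in> range (trunc2 N)"
  then have x': "fst x \<in> range (trunc N)" "snd x \<in> range (trunc N)" by (auto simp: range_trunc2)
  have "prob {\<omega> \<in> space M. trunc2 N (\<alpha> \<omega>) = x} =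
      prob ((\<lambda>\<omega>. (\<alpha>\<^sub>1 \<omega>, \<alpha>\<^sub>2 \<omega>)) -` (?C (fst x) \<times> ?C (snd x)) \<inter> space M)"
    unfolding eq by (rule arg_cong[of _ _ prob]) auto
  also have "\<dots> = prob (\<alpha>\<^sub>1 -` ?C (fst x) \<inter> space M) * prob (\<alpha>\<^sub>2 -` ?C (snd x) \<inter> space M)"
    by (rule indep_varD[OF indep trunc_fibre_sets trunc_fibre_sets])
  also have "\<dots> = 1 / card (range (trunc2 N :: 'a fps \<times> 'a fps \<Rightarrow> _))"
    unfolding haar_random_fibre[OF haar1 x'(1)] haar_random_fibre[OF haar2 x'(2)]
    by (simp add: range_trunc2 card_cartesian_product)
  finally show "prob {\<omega> \<in> space M. trunc2 N (\<alpha> \<omega>) = x} = \<dots>" .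
qed

text \<open>
  From here on, probabilities of events that depend on finitely many coefficients are relative
  cardinalities.
\<close>

lemma trunc2_event:
  "{\<omega> \<in> space M. trunc2 N (\<alpha> \<omega>) \<in> S} \<in> events"
  "prob {\<omega> \<in> space M. trunc2 N (\<alpha> \<omega>) \<in> S} =
     card (S \<inter> range (trunc2 N)) / card (range (trunc2 N :: 'a fps \<times> 'a fps \<Rightarrow> _))"
proof -
  let ?X = "range (trunc2 N :: 'a fps \<times> 'a fps \<Rightarrow> _)"
  have eq: "{\<omega> \<in> space M. trunc2 N (\<alpha> \<omega>) \<in> S} =
      (\<Union>x\<in>S \<inter> ?X. {\<omega> \<in> space M. trunc2 N (\<alpha> \<omega>) = x})" by auto
  show "{\<omega> \<in> space M. trunc2 N (\<alpha> \<omega>) \<in> S} \<in> events"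
    unfolding eq by (intro sets.finite_UN) (auto intro: trunc2_fibre)
  have "prob {\<omega> \<in> space M. trunc2 N (\<alpha> \<omega>) \<in> S} =
      (\<Sum>x\<in>S \<inter> ?X. prob {\<omega> \<in> space M. trunc2 N (\<alpha> \<omega>) = x})"
    unfolding eq
  proof (rule finite_measure_finite_Union)
    show "disjoint_family_on (\<lambda>x. {\<omega> \<in> space M. trunc2 N (\<alpha> \<omega>) = x}) (S \<inter> ?X)"
      unfolding disjoint_family_on_def by blast
  qed (auto intro: trunc2_fibre)
  also have "\<dots> = (\<Sum>x\<in>S \<inter> ?X. 1 / card ?X)" by (rule sum.cong) (auto intro: trunc2_fibre(2))
  finally show "prob {\<omega> \<in> space M. trunc2 N (\<alpha> \<omega>) \<in> S} = card (S \<inter> ?X) / card ?X" by simp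
qed

text \<open>
  Every array of coefficients has positive probability and therefore occurs. This makes it possible
  to translate events, which live on the sample space, into sets of arrays without loss.
\<close>

lemma trunc2_attained:
  assumes "x \<in> range (trunc2 N)"
  obtains \<omega> where "\<omega> \<in> space M" "trunc2 N (\<alpha> \<omega>) = x"
proof -
  have "prob {\<omega> \<in> space M. trunc2 N (\<alpha> \<omega>) = x} > 0"
    unfolding trunc2_fibre(2)[OF assms] by (simp add: card_gt_0_iff)
  then have "{\<omega> \<in> space M. trunc2 N (\<alpha> \<omega>) = x} \<noteq> {}" by (metis less_irrefl measure_empty)
  then show ?thesis using that by blast
qed

abbreviation \<F> :: "nat \<Rightarrow> 'w measure" where "\<F> \<equiv> coeff_filtration M \<alpha>"

lemma space_coeff_filtration: "space (\<F> N) = space M"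
  unfolding coeff_filtration_def by (rule space_measure_of) auto

text \<open>
  The generated \<sigma>-algebra has finitely many atoms, the fibres of the truncation, so its events are
  precisely the conditions on the truncated series.
\<close>

lemma sets_coeff_filtration: "sets (\<F> N) = range (\<lambda>S. {\<omega> \<in> space M. trunc2 N (\<alpha> \<omega>) \<in> S})"
proof
  let ?G = "{{\<omega> \<in> space M. fps_nth (p (\<alpha> \<omega>)) j \<in> S} | p j S. p \<in> {fst, snd} \<and> 1 \<le> j \<and> j \<le> N}"
  have sets_F: "sets (\<F> N) = sigma_sets (space M) ?G"
    unfolding coeff_filtration_def by (rule sets_measure_of) auto
  let ?V = "vimage_algebra (space M) (\<lambda>\<omega>. trunc2 N (\<alpha> \<omega>)) (count_space UNIV)"
  have V: "sets ?V = range (\<lambda>S. {\<omega> \<in> space M. trunc2 N (\<alpha> \<omega>) \<in> S})"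
    by (subst sets_vimage_algebra2) (auto simp: image_iff)
  have "?G \<subseteq> sets ?V"
  proof clarify
    fix p j S assume *: "p \<in> {fst :: 'a fps \<times> 'a fps \<Rightarrow> _, snd}" "1 \<le> j" "j \<le> N"
    then have "{\<omega> \<in> space M. fps_nth (p (\<alpha> \<omega>)) j \<in> S} =
        {\<omega> \<in> space M. trunc2 N (\<alpha> \<omega>) \<in> {x. fps_nth (p x) j \<in> S}}"
      by (auto simp: trunc2_def map_prod_def split_beta)
    then show "{\<omega> \<in> space M. fps_nth (p (\<alpha> \<omega>)) j \<in> S} \<in> sets ?V" unfolding V by blast
  qed
  then show "sets (\<F> N) \<subseteq> range (\<lambda>S. {\<omega> \<in> space M. trunc2 N (\<alpha> \<omega>) \<in> S})"
    unfolding sets_F V[symmetric] using sets.sigma_sets_subset[of ?G ?V] by simp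
  have gen: "{\<omega> \<in> space (\<F> N). fps_nth (p (\<alpha> \<omega>)) j = c} \<in> sets (\<F> N)"
    if "p \<in> {fst, snd}" "j \<in> {1..N}" for p j c
    unfolding sets_F space_coeff_filtration using that
    by (intro sigma_sets.Basic CollectI exI[of _ p] exI[of _ j] exI[of _ "{c}"]) auto
  show "range (\<lambda>S. {\<omega> \<in> space M. trunc2 N (\<alpha> \<omega>) \<in> S}) \<subseteq> sets (\<F> N)"
  proof clarify
    fix S
    have fibre: "{\<omega> \<in> space M. trunc2 N (\<alpha> \<omega>) = trunc2 N x} \<in> sets (\<F> N)" for x
    proof -
      have "{\<omega> \<in> space (\<F> N). \<forall>j\<in>{1..N}. fps_nth (fst (\<alpha> \<omega>)) j = fps_nth (fst x) j \<and>
               fps_nth (snd (\<alpha> \<omega>)) j = fps_nth (snd x) j} \<in> sets (\<F> N)"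
        by (intro sets.sets_Collect_finite_All sets.sets_Collect_conj gen) auto
      then show ?thesis
        by (simp add: space_coeff_filtration trunc2_eq_iff coeff_pair_def)
    qed
    have "{\<omega> \<in> space M. trunc2 N (\<alpha> \<omega>) \<in> S} =
        (\<Union>x\<in>S \<inter> range (trunc2 N). {\<omega> \<in> space M. trunc2 N (\<alpha> \<omega>) = x})" by auto
    also have "\<dots> \<in> sets (\<F> N)"
      by (intro sets.finite_UN) (auto intro: fibre)
    finally show "{\<omega> \<in> space M. trunc2 N (\<alpha> \<omega>) \<in> S} \<in> sets (\<F> N)" .
  qed
qed

lemma coeff_filtration_eventI:
  assumes "\<And>z. P (trunc2 N z) \<longleftrightarrow> P z"
  shows "{\<omega> \<in> space M. P (\<alpha> \<omega>)} \<in> sets (\<F> N)"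
  unfolding sets_coeff_filtration by (rule range_eqI[of _ _ "Collect P"]) (simp only: mem_Collect_eq assms)

end

section \<open>The stopped \<sigma>-algebra\<close>

lemma Dn_trunc2:
  fixes z :: "'a::{field, finite} fps \<times> 'a fps"
  assumes "3 * n \<le> N"
  shows "Dn (trunc2 N z) n = Dn z n"
  unfolding Dn_eq using ann_length_bound[of z n 0] assms
  by (intro ann_length_cong[of N]) simp_all

lemma ann_length_trunc2:
  fixes z :: "'a::{field, finite} fps \<times> 'a fps"
  assumes "3 * n + j \<le> N"
  shows "ann_length (trunc2 N z) n j = ann_length z n j"
  using ann_length_bound[of z n j] assms by (intro ann_length_cong[of N]) simp_all

lemma Jn_trunc2:
  fixes z :: "'a::{field, finite} fps \<times> 'a fps"
  assumes "3 * n + 3 \<le> N"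
  shows "Jn (trunc2 N z) n = Jn z n"
  using assms Dn_trunc2[of n N z] Dn_trunc2[of "Suc n" N z] by (simp add: Jn_def)

lemma In_trunc2:
  fixes z :: "'a::{field, finite} fps \<times> 'a fps"
  assumes "3 * n + 3 \<le> N" "j \<in> {1, 2}"
  shows "In (trunc2 N z) n = j \<longleftrightarrow> In z n = j"
  using assms Dn_trunc2[of "Suc n" N z] ann_length_trunc2[of n j N z] 
  unfolding In_eq_iff[OF assms(2)] Jn_trunc2[OF assms(1)] by auto

text \<open>
  Whether \<open>n + D\<^sub>n \<le> t\<close> is decided by the first \<open>t\<close> coefficients: this is what makes it a stopping time.
\<close>

lemma Dn_stop_trunc2:
  fixes z :: "'a::{field, finite} fps \<times> 'a fps"
  shows "n + Dn (trunc2 t z) n \<le> t \<longleftrightarrow> n + Dn z n \<le> t"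
proof
  assume "n + Dn (trunc2 t z) n \<le> t"
  then show "n + Dn z n \<le> t"
    using ann_length_cong[of t "trunc2 t z" z n 0] by (simp add: Dn_eq)
next
  assume "n + Dn z n \<le> t"
  then show "n + Dn (trunc2 t z) n \<le> t"
    using ann_length_cong[of t z "trunc2 t z" n 0] by (simp add: Dn_eq)
qed

lemma Tn_Suc: "Tn (z :: 'a::{field, finite} fps \<times> 'a fps) n + 1 = n + Dn z n"
  using ann_lengths_ge_1[OF ann_length_in[of z n 0]] by (simp add: Tn_def Dn_eq)

lemma Dn_ge_1: "1 \<le> Dn (z :: 'a::{field, finite} fps \<times> 'a fps) n"
  unfolding Dn_eq by (rule ann_lengths_ge_1[OF ann_length_in])

lemma Dn_le: "Dn (z :: 'a::{field, finite} fps \<times> 'a fps) n \<le> 2 * n + 1"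
  using ann_length_bound[of z n 0] by (simp add: Dn_eq)

context haar_pair
begin

lemma filtration_coeff: "filtration (space M) \<F>"
proof
  fix i j :: nat assume "i \<le> j"
  have "{\<omega> \<in> space M. trunc2 i (\<alpha> \<omega>) \<in> S} \<in> sets (\<F> j)" for S
  proof (rule coeff_filtration_eventI)
    show "trunc2 i (trunc2 j z) \<in> S \<longleftrightarrow> trunc2 i z \<in> S" for z
      using \<open>i \<le> j\<close> by (simp add: min_absorb1)
  qed
  then show "sets (\<F> i) \<subseteq> sets (\<F> j)" unfolding sets_coeff_filtration[of i] by blast
qed (rule space_coeff_filtration)

context
  fixes n :: nat
begin

abbreviation stop :: "'w \<Rightarrow> nat" where "stop \<omega> \<equiv> Tn (\<alpha> \<omega>) n + 1"
abbreviation F_stop :: "'w measure" where "F_stop \<equiv> stopped_sigma M \<alpha> stop"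

lemma stopping_time_stop: "stopping_time \<F> stop"
proof
  fix t
  have "{\<omega> \<in> space M. n + Dn (\<alpha> \<omega>) n \<le> t} \<in> sets (\<F> t)"
    by (rule coeff_filtration_eventI) (rule Dn_stop_trunc2)
  then show "Measurable.pred (\<F> t) (\<lambda>\<omega>. stop \<omega> \<le> t)"
    unfolding pred_def space_coeff_filtration Tn_Suc .
qed

lemma sets_F_stop: "sets F_stop = {A. \<forall>t. {\<omega> \<in> A. stop \<omega> \<le> t} \<in> sets (\<F> t)}"
  unfolding stopped_sigma_def by (rule filtration.sets_pre_sigma[OF filtration_coeff stopping_time_stop])

lemma space_F_stop: "space F_stop = space M"
  unfolding stopped_sigma_def by (rule filtration.space_pre_sigma[OF filtration_coeff])

lemma stop_le: "stop \<omega> \<le> 3 * n + 1"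
  using ann_length_bound[of "\<alpha> \<omega>" n 0] unfolding Tn_Suc Dn_eq by simp

text \<open>
  An event of the stopped \<sigma>-algebra cannot separate outcomes with the same coefficients up to the
  stopping time of one of them.
\<close>

lemma F_stop_saturated:
  assumes A: "A \<in> sets F_stop" and \<omega>: "\<omega> \<in> A" "\<omega>' \<in> space M"
    and eq: "trunc2 (stop \<omega>) (\<alpha> \<omega>) = trunc2 (stop \<omega>) (\<alpha> \<omega>')"
  shows "\<omega>' \<in> A"
proof -
  have "{\<omega>' \<in> A. stop \<omega>' \<le> stop \<omega>} \<in> sets (\<F> (stop \<omega>))"
    using A unfolding sets_F_stop by blast
  then obtain S where S: "{\<omega>' \<in> A. stop \<omega>' \<le> stop \<omega>} = {\<omega>' \<in> space M. trunc2 (stop \<omega>) (\<alpha> \<omega>') \<in> S}"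
    unfolding sets_coeff_filtration by blast
  have "\<omega> \<in> {\<omega>' \<in> A. stop \<omega>' \<le> stop \<omega>}" using \<omega>(1) by simp
  then have "trunc2 (stop \<omega>) (\<alpha> \<omega>) \<in> S" unfolding S by blast
  then have "trunc2 (stop \<omega>) (\<alpha> \<omega>') \<in> S" unfolding eq .
  then show ?thesis using \<omega>(2) S by blast
qed

text \<open>
  The stopping time is bounded, so a stopped event is a condition on one fixed truncation; what
  remains of the stopping is the closure property in the last clause, which is the hypothesis of
  \<open>card_first_index\<close>.
\<close>

lemma F_stop_representation:
  assumes A: "A \<in> sets F_stop" and N: "3 * n + 1 \<le> N"
  obtains S where "S \<subseteq> range (trunc2 N)" "A = {\<omega> \<in> space M. trunc2 N (\<alpha> \<omega>) \<in> S}"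
    "\<And>x y. x \<in> S \<Longrightarrow> y \<in> range (trunc2 N) \<Longrightarrow>
       trunc2 (n + Dn x n) x = trunc2 (n + Dn x n) y \<Longrightarrow> y \<in> S"
proof
  let ?S = "(\<lambda>\<omega>. trunc2 N (\<alpha> \<omega>)) ` A"
  have AM: "A \<subseteq> space M" using sets.sets_into_space[OF A] unfolding space_F_stop .
  show "?S \<subseteq> range (trunc2 N)" by blast
  have le: "stop \<omega> \<le> N" for \<omega> using stop_le[of \<omega>] N by linarith
  show "A = {\<omega> \<in> space M. trunc2 N (\<alpha> \<omega>) \<in> ?S}"
  proof (intro equalityI subsetI)
    fix \<omega>' assume "\<omega>' \<in> {\<omega> \<in> space M. trunc2 N (\<alpha> \<omega>) \<in> ?S}"
    then obtain \<omega> where \<omega>: "\<omega>' \<in> space M" "\<omega> \<in> A" "trunc2 N (\<alpha> \<omega>) = trunc2 N (\<alpha> \<omega>')" by auto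
    then show "\<omega>' \<in> A" using F_stop_saturated[OF A] trunc2_eq_mono[OF _ le] by blast
  qed (use AM in auto)
  fix x y assume x: "x \<in> ?S" and y: "y \<in> range (trunc2 N)"
    and eq: "trunc2 (n + Dn x n) x = trunc2 (n + Dn x n) y"
  from x obtain \<omega> where \<omega>: "\<omega> \<in> A" "x = trunc2 N (\<alpha> \<omega>)" by blast
  obtain \<omega>' where \<omega>': "\<omega>' \<in> space M" "trunc2 N (\<alpha> \<omega>') = y" using y by (rule trunc2_attained)
  have "n + Dn x n = stop \<omega>" unfolding \<omega>(2) Tn_Suc using N by (simp add: Dn_trunc2)
  with eq have "trunc2 (stop \<omega>) (\<alpha> \<omega>) = trunc2 (stop \<omega>) (\<alpha> \<omega>')"
    unfolding \<omega>(2) \<omega>'(2)[symmetric] using le[of \<omega>] by (simp add: min_absorb1)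
  then have "\<omega>' \<in> A" using F_stop_saturated[OF A \<omega>(1) \<omega>'(1)] by blast
  then show "y \<in> ?S" using \<omega>'(2) by blast
qed

lemma subalgebra_F_stop: "subalgebra M F_stop"
  unfolding subalgebra_def
proof (intro conjI subsetI)
  fix A assume "A \<in> sets F_stop"
  then obtain S where "A = {\<omega> \<in> space M. trunc2 (3 * n + 1) (\<alpha> \<omega>) \<in> S}"
    by (rule F_stop_representation[OF _ order.refl])
  then show "A \<in> sets M" using trunc2_event(1) by simp
qed (rule space_F_stop)

lemma jump_in_F_stop: "{\<omega> \<in> space M. Jn (\<alpha> \<omega>) n = 1} \<in> sets F_stop"
  unfolding sets_F_stop
proof (intro CollectI allI)
  fix t
  have "{\<omega> \<in> space M. Jn (\<alpha> \<omega>) n = 1 \<and> n + Dn (\<alpha> \<omega>) n \<le> t} \<in> sets (\<F> t)"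
  proof (rule coeff_filtration_eventI)
    fix z :: "'a fps \<times> 'a fps"
    have "Jn (trunc2 t z) n = 1 \<longleftrightarrow> Jn z n = 1" if "n + Dn z n \<le> t"
      by (rule Jn_stopped) (use that in \<open>simp add: min_absorb1\<close>)
    then show "Jn (trunc2 t z) n = 1 \<and> n + Dn (trunc2 t z) n \<le> t \<longleftrightarrow>
        Jn z n = 1 \<and> n + Dn z n \<le> t"
      unfolding Dn_stop_trunc2 by blast
  qed
  then show "{\<omega> \<in> {\<omega> \<in> space M. Jn (\<alpha> \<omega>) n = 1}. stop \<omega> \<le> t} \<in> sets (\<F> t)"
    unfolding Tn_Suc by (simp add: conj_assoc)
qed

lemma In_event: "j \<in> {1, 2} \<Longrightarrow> {\<omega> \<in> space M. In (\<alpha> \<omega>) n = j} \<in> events"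
  using trunc2_event(1)[of "3 * n + 3" "{x. In x n = j}"] by (simp add: In_trunc2)

lemma Jn_event: "{\<omega> \<in> space M. Jn (\<alpha> \<omega>) n = 1} \<in> events"
  using trunc2_event(1)[of "3 * n + 3" "{x. Jn x n = 1}"] by (simp add: Jn_trunc2)

section \<open>Conditional law of the jump index and tail of the jump\<close>

lemma prob_first_index:
  assumes A: "A \<in> sets F_stop"
  shows "prob (A \<inter> {\<omega> \<in> space M. In (\<alpha> \<omega>) n = 1}) =
    1 / real CARD('a) * prob (A \<inter> {\<omega> \<in> space M. Jn (\<alpha> \<omega>) n = 1})"
proof -
  let ?N = "3 * n + 3"
  let ?X = "range (trunc2 ?N :: 'a fps \<times> 'a fps \<Rightarrow> _)"
  have N: "3 * n + 1 \<le> ?N" by simp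
  obtain S where S: "S \<subseteq> ?X" "A = {\<omega> \<in> space M. trunc2 ?N (\<alpha> \<omega>) \<in> S}"
    and stopped: "\<And>x y. x \<in> S \<Longrightarrow> y \<in> ?X \<Longrightarrow> trunc2 (n + Dn x n) x = trunc2 (n + Dn x n) y \<Longrightarrow> y \<in> S"
  proof (rule F_stop_representation[OF A N])
    fix S assume "S \<subseteq> ?X" "A = {\<omega> \<in> space M. trunc2 ?N (\<alpha> \<omega>) \<in> S}"
      and "\<And>x y. x \<in> S \<Longrightarrow> y \<in> ?X \<Longrightarrow> trunc2 (n + Dn x n) x = trunc2 (n + Dn x n) y \<Longrightarrow> y \<in> S"
    then show thesis by (rule that)
  qed
  have prob: "prob (A \<inter> {\<omega> \<in> space M. P (\<alpha> \<omega>)}) = card {x \<in> S. P x} / card ?X"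
    if P: "\<And>z. P (trunc2 ?N z) \<longleftrightarrow> P z" for P
  proof -
    have "A \<inter> {\<omega> \<in> space M. P (\<alpha> \<omega>)} = {\<omega> \<in> space M. trunc2 ?N (\<alpha> \<omega>) \<in> {x \<in> S. P x}}"
    proof -
      have "P (trunc2 ?N (\<alpha> \<omega>)) \<longleftrightarrow> P (\<alpha> \<omega>)" for \<omega> by (rule P)
      then show ?thesis unfolding S(2) by auto
    qed
    moreover have "{x \<in> S. P x} \<inter> ?X = {x \<in> S. P x}" using S(1) by blast
    ultimately show ?thesis using trunc2_event(2)[of ?N "{x \<in> S. P x}"] by simp
  qed
  have "CARD('a) * card {x \<in> S. In x n = 1} = card {x \<in> S. Jn x n = 1}"
  proof (rule card_first_index[OF _ S(1)])
    show "3 * n + 2 \<le> ?N" by simp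
    show "y \<in> S" if "x \<in> S" "y \<in> ?X" "trunc2 (n + Dn x n) x = trunc2 (n + Dn x n) y" for x y
      using that by (rule stopped)
  qed
  then have "real (CARD('a) * card {x \<in> S. In x n = 1}) = real (card {x \<in> S. Jn x n = 1})"
    by (rule arg_cong)
  then have "real (card {x \<in> S. Jn x n = 1}) = real CARD('a) * card {x \<in> S. In x n = 1}"
    by simp
  moreover have "prob (A \<inter> {\<omega> \<in> space M. In (\<alpha> \<omega>) n = 1}) = card {x \<in> S. In x n = 1} / card ?X"
    by (rule prob) (simp add: In_trunc2)
  moreover have "prob (A \<inter> {\<omega> \<in> space M. Jn (\<alpha> \<omega>) n = 1}) = card {x \<in> S. Jn x n = 1} / card ?X"
    by (rule prob) (simp add: Jn_trunc2)
  ultimately show ?thesis by simp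
qed

lemma prob_second_index:
  assumes A: "A \<in> sets F_stop"
  shows "prob (A \<inter> {\<omega> \<in> space M. In (\<alpha> \<omega>) n = 2}) =
    (1 - 1 / real CARD('a)) * prob (A \<inter> {\<omega> \<in> space M. Jn (\<alpha> \<omega>) n = 1})"
proof -
  let ?I = "\<lambda>j. A \<inter> {\<omega> \<in> space M. In (\<alpha> \<omega>) n = j}"
  have AM: "A \<in> events" using A subalgebra_F_stop by (auto simp: subalgebra_def)
  have "In z n = 1 \<or> In z n = 2 \<longleftrightarrow> Jn z n = 1" for z :: "'a fps \<times> 'a fps"
    using In_eq_iff[of 1 z n] In_eq_iff[of 2 z n] jump_index_cases[of z n] by auto
  then have "A \<inter> {\<omega> \<in> space M. Jn (\<alpha> \<omega>) n = 1} = ?I 1 \<union> ?I 2" by blast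
  moreover have "prob (?I 1 \<union> ?I 2) = prob (?I 1) + prob (?I 2)"
    by (rule finite_measure_Union) (auto intro!: sets.Int AM In_event)
  ultimately show ?thesis using prob_first_index[OF A] by (simp add: algebra_simps)
qed

text \<open>
  The jump indicator is measurable for the stopped \<sigma>-algebra, so a multiple of it is the conditional
  probability as soon as the integrals over all stopped events agree.
\<close>

lemma cond_prob_on_jump:
  assumes E: "{\<omega> \<in> space M. P \<omega>} \<in> events"
    and c: "\<And>A. A \<in> sets F_stop \<Longrightarrow> prob (A \<inter> {\<omega> \<in> space M. P \<omega>}) =
       c * prob (A \<inter> {\<omega> \<in> space M. Jn (\<alpha> \<omega>) n = 1})"
  shows "AE \<omega> in M. cond_prob_given M F_stop P \<omega> = (if Jn (\<alpha> \<omega>) n = 1 then 1 else 0) * c"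
proof -
  interpret F: finite_measure_subalgebra M F_stop
    by unfold_locales (rule subalgebra_F_stop)
  let ?J = "{\<omega> \<in> space M. Jn (\<alpha> \<omega>) n = 1}" and ?E = "{\<omega> \<in> space M. P \<omega>}"
  have "AE \<omega> in M. real_cond_exp M F_stop (indicat_real ?E) \<omega> = c * indicat_real ?J \<omega>"
  proof (rule F.real_cond_exp_charact)
    fix A assume A: "A \<in> sets F_stop"
    then have AM: "A \<in> events" using subalgebra_F_stop by (auto simp: subalgebra_def)
    have "(LINT \<omega>:A|M. indicat_real ?E \<omega>) = prob (A \<inter> ?E)"
      unfolding set_lebesgue_integral_def using AM E
      by (simp add: indicator_inter_arith[symmetric])
    also have "\<dots> = c * prob (A \<inter> ?J)" by (rule c[OF A])
    also have "\<dots> = (LINT \<omega>:A|M. c * indicat_real ?J \<omega>)"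
      unfolding set_lebesgue_integral_def using AM Jn_event
      by (simp add: indicator_inter_arith[symmetric] mult.left_commute)
    finally show "(LINT \<omega>:A|M. indicat_real ?E \<omega>) = (LINT \<omega>:A|M. c * indicat_real ?J \<omega>)" .
  next
    show "integrable M (indicat_real ?E)"
      using E by (simp add: emeasure_eq_measure)
    show "integrable M (\<lambda>\<omega>. c * indicat_real ?J \<omega>)"
      using Jn_event by (intro integrable_mult_right) (simp add: emeasure_eq_measure)
    show "(\<lambda>\<omega>. c * indicat_real ?J \<omega>) \<in> borel_measurable F_stop"
      using jump_in_F_stop by measurable
  qed
  then show ?thesis
    unfolding cond_prob_given_def by (rule AE_mp) (auto intro!: AE_I2)
qed

lemma prob_eq_card:
  assumes P: "\<And>z. P (trunc2 N z) \<longleftrightarrow> P z"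
  shows "prob {\<omega> \<in> space M. P (\<alpha> \<omega>)} =
    card {x \<in> range (trunc2 N). P x} / card (range (trunc2 N :: 'a fps \<times> 'a fps \<Rightarrow> _))"
proof -
  have "{\<omega> \<in> space M. P (\<alpha> \<omega>)} = {\<omega> \<in> space M. trunc2 N (\<alpha> \<omega>) \<in> Collect P}"
    using P by blast
  moreover have "Collect P \<inter> range (trunc2 N) = {x \<in> range (trunc2 N). P x}" by blast
  ultimately show ?thesis using trunc2_event(2)[of N "Collect P"] by simp
qed

lemma prob_jump_and_Dn_le:
  "prob {\<omega> \<in> space M. Dn (\<alpha> \<omega>) n \<le> d \<and> Jn (\<alpha> \<omega>) n = 1} =
    (1 - 1 / real CARD('a)^2) * prob {\<omega> \<in> space M. Dn (\<alpha> \<omega>) n \<le> d}"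
proof -
  let ?N = "3 * n + 3" and ?q = "CARD('a)"
  let ?X = "range (trunc2 ?N :: 'a fps \<times> 'a fps \<Rightarrow> _)"
  let ?a = "card {x \<in> ?X. Dn x n \<le> d \<and> Jn x n = 1}" and ?b = "card {x \<in> ?X. Dn x n \<le> d}"
  have "?q\<^sup>2 * ?a = (?q\<^sup>2 - 1) * ?b" by (rule card_jump) simp
  then have "real (?q\<^sup>2 * ?a) = real ((?q\<^sup>2 - 1) * ?b)" by (rule arg_cong)
  moreover have "1 \<le> ?q\<^sup>2" using card_field_gt_1[where 'a = 'a] by simp
  ultimately have "(real ?q)\<^sup>2 * ?a = ((real ?q)\<^sup>2 - 1) * ?b" by (simp add: of_nat_diff)
  then have a: "?a = (1 - 1 / (real ?q)\<^sup>2) * ?b" by (simp add: field_simps)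
  have "prob {\<omega> \<in> space M. Dn (\<alpha> \<omega>) n \<le> d \<and> Jn (\<alpha> \<omega>) n = 1} = ?a / card ?X"
    by (rule prob_eq_card[of "\<lambda>z. Dn z n \<le> d \<and> Jn z n = 1"]) (simp add: Dn_trunc2 Jn_trunc2)
  moreover have "prob {\<omega> \<in> space M. Dn (\<alpha> \<omega>) n \<le> d} = ?b / card ?X"
    by (rule prob_eq_card[of "\<lambda>z. Dn z n \<le> d"]) (simp add: Dn_trunc2)
  ultimately show ?thesis using a by simp
qed

lemma prob_Dn_le:
  assumes "d \<le> 2 * n + 1"
  shows "prob {\<omega> \<in> space M. Dn (\<alpha> \<omega>) n \<le> d} \<le>
    real CARD('a) ^ d / (real CARD('a) ^ (2 * n) * (real CARD('a) - 1))"
proof -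
  let ?N = "3 * n + 3" and ?q = "CARD('a)"
  let ?X = "range (trunc2 ?N :: 'a fps \<times> 'a fps \<Rightarrow> _)"
  let ?b = "card {x \<in> ?X. Dn x n \<le> d}"
  have q: "?q > 1" by (rule card_field_gt_1)
  have "(?q - 1) * ?q ^ (2 * n) * ?b \<le> ?q ^ d * card ?X"
    using assms by (intro card_Dn_le) simp
  then have "real ((?q - 1) * ?q ^ (2 * n) * ?b) \<le> real (?q ^ d * card ?X)"
    by (rule of_nat_mono)
  then have "(real ?q - 1) * real ?q ^ (2 * n) * ?b \<le> real ?q ^ d * card ?X"
    using q by (simp add: of_nat_diff)
  moreover have "card ?X > 0" by (simp add: card_gt_0_iff)
  ultimately have "?b / card ?X \<le> real ?q ^ d / (real ?q ^ (2 * n) * (real ?q - 1))"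
    using q by (simp add: field_simps)
  moreover have "prob {\<omega> \<in> space M. Dn (\<alpha> \<omega>) n \<le> d} = ?b / card ?X"
    by (rule prob_eq_card[of "\<lambda>z. Dn z n \<le> d"]) (simp add: Dn_trunc2)
  ultimately show ?thesis by simp
qed

text \<open>
  A large jump forces \<open>D\<^sub>n\<close> to be small, and conditioning on the jump does not change the law of \<open>D\<^sub>n\<close>.
\<close>

lemma large_jump_tail:
  fixes h :: int
  assumes h: "h \<ge> 3"
  shows "\<P>(\<omega> in M. Deltan (\<alpha> \<omega>) n \<ge> h \<bar> Jn (\<alpha> \<omega>) n = 1) \<le>
    real CARD('a) powi (3 - h) / (real CARD('a) - 1)"
proof -
  let ?q = "real CARD('a)"
  let ?D = "\<lambda>d. {\<omega> \<in> space M. Dn (\<alpha> \<omega>) n \<le> d}"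
  have q: "?q > 1" using card_field_gt_1[where 'a = 'a] by simp
  then have q2: "1 - 1 / ?q^2 > 0" by (simp add: field_simps power_gt1)
  have "?D (2 * n + 1) = space M"
    by (simp only: Dn_le) simp
  moreover have "{\<omega> \<in> space M. Dn (\<alpha> \<omega>) n \<le> 2 * n + 1 \<and> Jn (\<alpha> \<omega>) n = 1} =
      {\<omega> \<in> space M. Jn (\<alpha> \<omega>) n = 1}"
    by (simp only: Dn_le simp_thms)
  ultimately have J: "prob {\<omega> \<in> space M. Jn (\<alpha> \<omega>) n = 1} = 1 - 1 / ?q^2"
    using prob_jump_and_Dn_le[of "2 * n + 1"] prob_space by simp
  \<comment> \<open>For \<open>h > 2n + 2\<close> this is 0, and the event below is empty because \<open>D\<^sub>n \<ge> 1\<close>.\<close>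
  define d where "d = nat (2 * int n + 3 - h)"
  have "prob {\<omega> \<in> space M. Deltan (\<alpha> \<omega>) n \<ge> h \<and> Jn (\<alpha> \<omega>) n = 1} \<le>
      prob {\<omega> \<in> space M. Dn (\<alpha> \<omega>) n \<le> d \<and> Jn (\<alpha> \<omega>) n = 1}"
  proof (rule finite_measure_mono)
    show "{\<omega> \<in> space M. Deltan (\<alpha> \<omega>) n \<ge> h \<and> Jn (\<alpha> \<omega>) n = 1} \<subseteq>
        {\<omega> \<in> space M. Dn (\<alpha> \<omega>) n \<le> d \<and> Jn (\<alpha> \<omega>) n = 1}"
    proof clarify
      fix \<omega> assume "h \<le> Deltan (\<alpha> \<omega>) n"
      then show "Dn (\<alpha> \<omega>) n \<le> d" using Deltan_le[of "\<alpha> \<omega>" n] unfolding d_def by linarith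
    qed
    show "{\<omega> \<in> space M. Dn (\<alpha> \<omega>) n \<le> d \<and> Jn (\<alpha> \<omega>) n = 1} \<in> events"
      using trunc2_event(1)[of "3 * n + 3" "{z. Dn z n \<le> d \<and> Jn z n = 1}"]
      by (simp add: Dn_trunc2 Jn_trunc2)
  qed
  then have "\<P>(\<omega> in M. Deltan (\<alpha> \<omega>) n \<ge> h \<bar> Jn (\<alpha> \<omega>) n = 1) \<le> prob (?D d)"
    using q2 unfolding cond_prob_def J prob_jump_and_Dn_le by (simp add: field_simps)
  also have "\<dots> \<le> ?q powi (3 - h) / (?q - 1)"
  proof (cases "d = 0")
    case True
    then have "\<not> Dn (\<alpha> \<omega>) n \<le> d" for \<omega> using Dn_ge_1[of "\<alpha> \<omega>" n] by linarith
    then have "?D d = {}" by blast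
    then have "prob (?D d) = 0" by (simp only: measure_empty)
    moreover have "0 \<le> ?q powi (3 - h) / (?q - 1)"
      using q by (intro divide_nonneg_pos zero_le_power_int) simp_all
    ultimately show ?thesis by simp
  next
    case False
    then have d: "int d = 2 * int n + 3 - h" by (simp add: d_def)
    have "prob (?D d) \<le> ?q ^ d / (?q ^ (2 * n) * (?q - 1))"
      by (rule prob_Dn_le) (use d h in linarith)
    also have "?q ^ d / (?q ^ (2 * n) * (?q - 1)) = ?q powi (3 - h) / (?q - 1)"
    proof -
      have "?q powi (int d - int (2 * n)) = ?q ^ d / ?q ^ (2 * n)"
        using q by (simp add: power_int_diff del: of_nat_mult)
      moreover have "int d - int (2 * n) = 3 - h" using d by simp
      ultimately show ?thesis by simp
    qed
    finally show ?thesis .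
  qed
  finally show ?thesis .
qed

end

end

theorem corollary4p6:
  fixes M :: "'w measure"
    and \<alpha>\<^sub>1 \<alpha>\<^sub>2 :: "'w \<Rightarrow> 'a::{field, finite} fps"
    and n :: nat
  defines "q \<equiv> real CARD('a)"
    and "\<alpha> \<equiv> (\<lambda>\<omega>. (\<alpha>\<^sub>1 \<omega>, \<alpha>\<^sub>2 \<omega>))"
  defines "F \<equiv> stopped_sigma M \<alpha> (\<lambda>\<omega>. Tn (\<alpha> \<omega>) n + 1)"
  assumes "prob_space M"
    and "haar_random M \<alpha>\<^sub>1" and "haar_random M \<alpha>\<^sub>2"
    and "prob_space.indep_var M borel_pp \<alpha>\<^sub>1 borel_pp \<alpha>\<^sub>2"
  shows
    "(AE \<omega> in M. cond_prob_given M F (\<lambda>\<omega>. In (\<alpha> \<omega>) n = 1) \<omega>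
                   = (if Jn (\<alpha> \<omega>) n = 1 then 1 else 0) / q)
   \<and> (AE \<omega> in M. cond_prob_given M F (\<lambda>\<omega>. In (\<alpha> \<omega>) n = 2) \<omega>
                   = (if Jn (\<alpha> \<omega>) n = 1 then 1 else 0) * (1 - 1 / q))
   \<and> (AE \<omega> in M. Jn (\<alpha> \<omega>) n = 1 \<longrightarrow>
          cond_prob_given M F (\<lambda>\<omega>. Deltan (\<alpha> \<omega>) n = int (tau (\<alpha> \<omega>) n 1)) \<omega> = 1 / q)
   \<and> (\<forall>\<omega>\<in>space M. Jn (\<alpha> \<omega>) n = 1 \<and> Deltan (\<alpha> \<omega>) n \<noteq> int (tau (\<alpha> \<omega>) n 1) \<longrightarrow>
          Deltan (\<alpha> \<omega>) n = int (tau (\<alpha> \<omega>) n 2))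
   \<and> (\<forall>\<omega>\<in>space M. Deltan (\<alpha> \<omega>) n \<le> 2 * int n + 3 - int (Dn (\<alpha> \<omega>) n))
   \<and> (\<forall>h::int. h \<ge> 3 \<longrightarrow>
          \<P>(\<omega> in M. Deltan (\<alpha> \<omega>) n \<ge> h \<bar> Jn (\<alpha> \<omega>) n = 1) \<le> q powi (3 - h) / (q - 1))"
proof -
  interpret haar_pair M \<alpha>\<^sub>1 \<alpha>\<^sub>2
    using assms(4-7) by (intro haar_pair.intro haar_pair_axioms.intro)
  have \<alpha>: "haar_pair.\<alpha> \<alpha>\<^sub>1 \<alpha>\<^sub>2 = \<alpha>" unfolding \<alpha>_def assms(2) ..
  note stop_defs = assms(1) assms(3) \<alpha>[symmetric]
  have first: "In z n = 1 \<longleftrightarrow> Deltan z n = int (tau z n 1)" for z :: "'a fps \<times> 'a fps"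
    using In_eq_iff[of 1 z n] Deltan_eq_tau_iff[of 1 z n] ann_length_less[of 0 1 z n]
    unfolding Jn_eq_1_iff Dn_eq by auto
  have c1: "AE \<omega> in M. cond_prob_given M F (\<lambda>\<omega>. In (\<alpha> \<omega>) n = 1) \<omega>
      = (if Jn (\<alpha> \<omega>) n = 1 then 1 else 0) * (1 / q)"
    unfolding stop_defs by (rule cond_prob_on_jump[OF In_event prob_first_index]) simp_all
  have c2: "AE \<omega> in M. cond_prob_given M F (\<lambda>\<omega>. In (\<alpha> \<omega>) n = 2) \<omega>
      = (if Jn (\<alpha> \<omega>) n = 1 then 1 else 0) * (1 - 1 / q)"
    unfolding stop_defs by (rule cond_prob_on_jump[OF In_event prob_second_index]) simp_all
  have second: "Deltan z n = int (tau z n 2)"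
    if "Jn z n = 1" "Deltan z n \<noteq> int (tau z n 1)" for z :: "'a fps \<times> 'a fps"
    using that jump_index_cases[of z n] Deltan_eq_tau_iff[of _ z n] by simp
  show ?thesis
  proof (intro conjI allI ballI impI)
    show "AE \<omega> in M. cond_prob_given M F (\<lambda>\<omega>. In (\<alpha> \<omega>) n = 1) \<omega>
        = (if Jn (\<alpha> \<omega>) n = 1 then 1 else 0) / q"
      using c1 by simp
    show "AE \<omega> in M. Jn (\<alpha> \<omega>) n = 1 \<longrightarrow>
        cond_prob_given M F (\<lambda>\<omega>. Deltan (\<alpha> \<omega>) n = int (tau (\<alpha> \<omega>) n 1)) \<omega> = 1 / q"
      using c1 unfolding first by eventually_elim simp
    show "\<P>(\<omega> in M. Deltan (\<alpha> \<omega>) n \<ge> h \<bar> Jn (\<alpha> \<omega>) n = 1) \<le> q powi (3 - h) / (q - 1)"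
      if "h \<ge> 3" for h :: int
      unfolding stop_defs using that by (rule large_jump_tail)
  qed (use c2 second Deltan_le in blast)+
qed

end
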